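(* Let $\mu$ be a generalized semi-character of $X_+$ with $\mu\in\ell^2(X_+)$, let $a:X_+\setminus\{\chi_0\}\to\mathbb{C}$ be a function, and let $A_{\mu,a}$ be a $\mu$-Hankel operator. Then $A_{\mu,a}$ extends from $\mathrm{span}(X_+)$ to a bounded operator from $H^2(G)$ to $H^2_-(G)$ if and only if $a\in\ell^2(X_+\setminus\{\chi_0\})$. In this case the extension is unique and $$\|A_{\mu,a}\|\le\|\mu\|_{\ell^2(X_+)}\,\|a\|_{\ell^2(X_+\setminus\{\chi_0\})}.$$
   Context: $G$ is a compact connected Abelian group with normalized Haar measure, $X$ is its (discrete, multiplicatively written) dual group of continuous characters, viewed as functions on $G$, and a total order compatible with the group structure is fixed on $X$. $\chi_0\equiv 1$ is the unit character, $X_+=\{\chi\in X:\chi\ge\chi_0\}$ and $X_-=X\setminus X_+=\{\overline{\xi}:\xi\in X_+\setminus\{\chi_0\}\}$, where the bar is complex conjugation (so $\overline{\xi}=\xi^{-1}$). $H^2(G)=\{f\in L^2(G):\widehat f(\chi)=0\ \forall\chi\in X_-\}$, where $\widehat f$ is the Fourier transform, and $H^2_-(G)=L^2(G)\ominus H^2(G)$; $X_+$ and $X_-$ are orthonormal bases of $H^2(G)$ and $H^2_-(G)$ respectively. $\langle\cdot,\cdot\rangle$ is the inner product of $L^2(G)$. A generalized semi-character of $X_+$ is a non-null (not identically zero) homomorphism $\mu$ of the semigroup $X_+$ into the multiplicative semigroup $\mathbb{C}$. Given such $\mu$ and a function $a:X_+\setminus\{\chi_0\}\to\mathbb{C}$,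 a $\mu$-Hankel operator $A_{\mu,a}$ is a linear operator from $H^2(G)$ to $H^2_-(G)$, defined at least on the linear subspace $\mathrm{span}(X_+)$ of $H^2(G)$, such that $\langle A_{\mu,a}\chi,\overline{\xi}\rangle=\mu(\chi)a(\chi\xi)$ for all $\chi\in X_+$, $\xi\in X_+\setminus\{\chi_0\}$. *)

theory Defs
  imports "HOL-Probability.Probability_Measure" "HOL-Library.Function_Algebras"
begin

text \<open>
  Compact Abelian groups are written additively. The pointwise operations on functions
  \<open>'g \<Rightarrow> complex\<close> (in particular the product of characters and the unit
  character \<open>1\<close>) come from \<^theory>\<open>HOL-Library.Function_Algebras\<close>.
\<close>

text \<open>
  The group need not be second countable, so regularity does not follow from the other
  clauses; together with them it determines Haar measure uniquely.
\<close>

definition normalized_haar :: "'g::topological_ab_group_add measure \<Rightarrow> bool" where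
  "normalized_haar m \<longleftrightarrow>
     sets m = sets borel \<and> prob_space m \<and>
     (\<forall>g. distr m borel ((+) g) = m) \<and>
     (\<forall>B\<in>sets borel. emeasure m B = (SUP K\<in>{K. K \<subseteq> B \<and> compact K}. emeasure m K)) \<and>
     (\<forall>B\<in>sets borel. emeasure m B = (INF U\<in>{U. B \<subseteq> U \<and> open U}. emeasure m U))"

definition dual_group :: "('g::topological_ab_group_add \<Rightarrow> complex) set" where
  "dual_group = {\<phi>. continuous_on UNIV \<phi> \<and> (\<forall>x y. \<phi> (x + y) = \<phi> x * \<phi> y) \<and> (\<forall>x. cmod (\<phi> x) = 1)}"

text \<open>The pair \<open>(\<phi>, \<psi>) \<in> R\<close> stands for \<open>\<phi> \<le> \<psi>\<close>.\<close>

definition dual_order :: "('g::topological_ab_group_add \<Rightarrow> complex) rel \<Rightarrow> bool" where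
  "dual_order R \<longleftrightarrow> linear_order_on dual_group R \<and>
     (\<forall>\<phi>\<in>dual_group. \<forall>\<psi>\<in>dual_group. \<forall>\<eta>\<in>dual_group.
        (\<phi>, \<psi>) \<in> R \<longrightarrow> (\<phi> * \<eta>, \<psi> * \<eta>) \<in> R)"

definition Xplus :: "('g::topological_ab_group_add \<Rightarrow> complex) rel \<Rightarrow> ('g \<Rightarrow> complex) set" where
  "Xplus R = {\<phi>\<in>dual_group. (1, \<phi>) \<in> R}"

definition Xminus :: "('g::topological_ab_group_add \<Rightarrow> complex) rel \<Rightarrow> ('g \<Rightarrow> complex) set" where
  "Xminus R = dual_group - Xplus R"

definition char_span :: "('g \<Rightarrow> complex) set \<Rightarrow> ('g \<Rightarrow> complex) set" where
  "char_span S = {\<lambda>x. \<Sum>\<phi>\<in>T. c \<phi> * \<phi> x | T c. finite T \<and> T \<subseteq> S}"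

text \<open>
  Elements of \<open>L\<^sup>2\<close> are handled through representatives: \<open>L2 m\<close> consists of functions,
  equality in \<open>L\<^sup>2\<close> is equality almost everywhere, and operators are required to respect it.
\<close>

definition L2 :: "'g measure \<Rightarrow> ('g \<Rightarrow> complex) set" where
  "L2 m = {f \<in> borel_measurable m. integrable m (\<lambda>x. (cmod (f x))\<^sup>2)}"

definition L2_eq :: "'g measure \<Rightarrow> ('g \<Rightarrow> complex) \<Rightarrow> ('g \<Rightarrow> complex) \<Rightarrow> bool" where
  "L2_eq m f g \<longleftrightarrow> (AE x in m. f x = g x)"

definition L2_inner :: "'g measure \<Rightarrow> ('g \<Rightarrow> complex) \<Rightarrow> ('g \<Rightarrow> complex) \<Rightarrow> complex" where
  "L2_inner m f g = (LINT x|m. f x * cnj (g x))"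

definition L2_norm :: "'g measure \<Rightarrow> ('g \<Rightarrow> complex) \<Rightarrow> real" where
  "L2_norm m f = sqrt (LINT x|m. (cmod (f x))\<^sup>2)"

definition fourier :: "'g measure \<Rightarrow> ('g \<Rightarrow> complex) \<Rightarrow> ('g \<Rightarrow> complex) \<Rightarrow> complex" where
  "fourier m f \<phi> = (LINT x|m. f x * cnj (\<phi> x))"

definition H2 :: "'g::topological_ab_group_add measure \<Rightarrow> ('g \<Rightarrow> complex) rel \<Rightarrow> ('g \<Rightarrow> complex) set" where
  "H2 m R = {f \<in> L2 m. \<forall>\<phi>\<in>Xminus R. fourier m f \<phi> = 0}"

definition H2_minus :: "'g::topological_ab_group_add measure \<Rightarrow> ('g \<Rightarrow> complex) rel \<Rightarrow> ('g \<Rightarrow> complex) set" where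
  "H2_minus m R = {f \<in> L2 m. \<forall>h\<in>H2 m R. L2_inner m f h = 0}"

definition L2_subspace :: "('g \<Rightarrow> complex) set \<Rightarrow> bool" where
  "L2_subspace D \<longleftrightarrow> 0 \<in> D \<and> (\<forall>f\<in>D. \<forall>g\<in>D. f + g \<in> D) \<and> (\<forall>c. \<forall>f\<in>D. (\<lambda>x. c * f x) \<in> D)"

definition linear_op ::
  "'g measure \<Rightarrow> ('g \<Rightarrow> complex) set \<Rightarrow> ('g \<Rightarrow> complex) set \<Rightarrow>
   (('g \<Rightarrow> complex) \<Rightarrow> ('g \<Rightarrow> complex)) \<Rightarrow> bool" where
  "linear_op m D E A \<longleftrightarrow>
     (\<forall>f\<in>D. A f \<in> E) \<and>
     (\<forall>f\<in>D. \<forall>g\<in>D. L2_eq m f g \<longrightarrow> L2_eq m (A f) (A g)) \<and>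
     (\<forall>f\<in>D. \<forall>g\<in>D. L2_eq m (A (f + g)) (A f + A g)) \<and>
     (\<forall>c. \<forall>f\<in>D. L2_eq m (A (\<lambda>x. c * f x)) (\<lambda>x. c * A f x))"

definition bounded_op ::
  "'g measure \<Rightarrow> ('g \<Rightarrow> complex) set \<Rightarrow> ('g \<Rightarrow> complex) set \<Rightarrow>
   (('g \<Rightarrow> complex) \<Rightarrow> ('g \<Rightarrow> complex)) \<Rightarrow> bool" where
  "bounded_op m D E A \<longleftrightarrow>
     linear_op m D E A \<and> (\<exists>C. \<forall>f\<in>D. L2_norm m (A f) \<le> C * L2_norm m f)"

text \<open>As for \<^const>\<open>onorm\<close>, the convention \<open>x / 0 = 0\<close> takes care of \<open>f = 0\<close>.\<close>

definition op_norm ::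
  "'g measure \<Rightarrow> ('g \<Rightarrow> complex) set \<Rightarrow> (('g \<Rightarrow> complex) \<Rightarrow> ('g \<Rightarrow> complex)) \<Rightarrow> real" where
  "op_norm m D A = (SUP f\<in>D. L2_norm m (A f) / L2_norm m f)"

definition ell2 :: "'a set \<Rightarrow> ('a \<Rightarrow> complex) \<Rightarrow> bool" where
  "ell2 S a \<longleftrightarrow> (\<lambda>s. (cmod (a s))\<^sup>2) summable_on S"

definition ell2_norm :: "'a set \<Rightarrow> ('a \<Rightarrow> complex) \<Rightarrow> real" where
  "ell2_norm S a = sqrt (\<Sum>\<^sub>\<infinity>s\<in>S. (cmod (a s))\<^sup>2)"

definition semi_character ::
  "('g::topological_ab_group_add \<Rightarrow> complex) rel \<Rightarrow> (('g \<Rightarrow> complex) \<Rightarrow> complex) \<Rightarrow> bool" where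
  "semi_character R \<mu> \<longleftrightarrow>
     (\<forall>\<phi>\<in>Xplus R. \<forall>\<psi>\<in>Xplus R. \<mu> (\<phi> * \<psi>) = \<mu> \<phi> * \<mu> \<psi>) \<and> (\<exists>\<phi>\<in>Xplus R. \<mu> \<phi> \<noteq> 0)"

text \<open>
  \<open>D\<close> is the domain of the operator \<open>A\<close>. Only the values of \<open>\<mu>\<close> on \<open>Xplus R\<close> and
  of \<open>a\<close> on \<open>Xplus R - {1}\<close> matter.
\<close>

definition mu_hankel ::
  "'g::topological_ab_group_add measure \<Rightarrow> ('g \<Rightarrow> complex) rel \<Rightarrow>
   (('g \<Rightarrow> complex) \<Rightarrow> complex) \<Rightarrow> (('g \<Rightarrow> complex) \<Rightarrow> complex) \<Rightarrow>
   ('g \<Rightarrow> complex) set \<Rightarrow> (('g \<Rightarrow> complex) \<Rightarrow> ('g \<Rightarrow> complex)) \<Rightarrow> bool" where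
  "mu_hankel m R \<mu> a D A \<longleftrightarrow>
     L2_subspace D \<and> char_span (Xplus R) \<subseteq> D \<and> D \<subseteq> H2 m R \<and>
     linear_op m D (H2_minus m R) A \<and>
     (\<forall>\<phi>\<in>Xplus R. \<forall>\<xi>\<in>Xplus R - {1}. L2_inner m (A \<phi>) (cnj \<circ> \<xi>) = \<mu> \<phi> * a (\<phi> * \<xi>))"

definition bounded_extension ::
  "'g::topological_ab_group_add measure \<Rightarrow> ('g \<Rightarrow> complex) rel \<Rightarrow>
   (('g \<Rightarrow> complex) \<Rightarrow> ('g \<Rightarrow> complex)) \<Rightarrow> (('g \<Rightarrow> complex) \<Rightarrow> ('g \<Rightarrow> complex)) \<Rightarrow> bool" where
  "bounded_extension m R A B \<longleftrightarrow>
     bounded_op m (H2 m R) (H2_minus m R) B \<and>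
     (\<forall>f\<in>char_span (Xplus R). L2_eq m (B f) (A f))"

end

theory Submission
  imports Defs
begin

text \<open>
  The operator is a Hilbert-Schmidt operator. In the orthonormal bases \<open>Xplus R\<close> and
  \<open>{cnj \<circ> \<xi> | \<xi> \<in> Xplus R - {1}}\<close> its matrix entry at \<open>(\<phi>, \<xi>)\<close> is
  \<open>\<mu> \<phi> * a (\<phi> * \<xi>)\<close>. Multiplication by \<open>\<phi>\<close> maps \<open>Xplus R - {1}\<close> injectively into
  itself, so the squares of the entries with a fixed \<open>\<phi>\<close> add up to at most
  \<open>\<bar>\<mu> \<phi>\<bar>\<^sup>2 \<parallel>a\<parallel>\<^sup>2\<close>, and all of them to at most \<open>\<parallel>\<mu>\<parallel>\<^sup>2 \<parallel>a\<parallel>\<^sup>2\<close>. This is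
  \<open>Hilbert_Schmidt_bound\<close>. It makes the prescribed coefficients of \<open>B f\<close> square
  summable, so that Riesz-Fischer produces \<open>B f\<close>; and it bounds the norm of every bounded
  extension, because continuity leaves no choice for the coefficients of \<open>B f\<close>
  (\<open>bounded_extension_coeff\<close>). Conversely \<open>\<mu> 1 = 1\<close>, so the coefficients of \<open>A 1\<close> are the
  values of \<open>a\<close>, and these are square summable because \<open>A 1\<close> lies in \<open>L\<^sup>2\<close>.

  Speaking of bases presupposes that the characters of a compact Abelian group are complete in
  \<open>L\<^sup>2\<close>, the Abelian case of the Peter-Weyl theorem (\<open>fourier_eq_0_imp_AE_0\<close>). Most of the
  text proves it, inside the convolution algebra of continuous functions and without spectral
  theory of compact operators. Let \<open>q \<noteq> 0\<close> be continuous with \<open>q = star q\<close>, where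
  \<open>star q x = cnj (q (- x))\<close>. The numbers \<open>T n\<close>, the squared \<open>L\<^sup>2\<close>-norms of the convolution
  powers of \<open>q\<close>, are the traces of the powers of the positive operator "convolve twice with
  \<open>q\<close>". They are log-convex and submultiplicative, so their ratios increase to a limit \<open>r > 0\<close>
  with \<open>T n \<ge> r\<^sup>n\<close> (up to the index shift), and this makes the rescaled even powers of \<open>q\<close>
  converge uniformly to a nonzero idempotent \<open>p\<close>: the kernel of the projection onto the top
  eigenspace (\<open>spectral_idempotent\<close>).

  The value \<open>p 0\<close> of a hermitian idempotent is the dimension of its range, and it is at least
  \<open>1\<close>; hence there are minimal idempotents below any given one
  (\<open>minimal_idempotent_below\<close>). The spectral construction applied inside the range of a
  minimal \<open>p\<close> can only return \<open>p\<close>, which forces the range to be one-dimensional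
  (\<open>minimal_idempotent_range\<close>). The translates of \<open>p\<close> lie in its range, so they are multiples
  of \<open>p\<close>, and \<open>p / p 0\<close> is a character (\<open>minimal_idempotent_character\<close>). If \<open>g\<close> is
  continuous and nonzero, a character found in this way below \<open>q = star g * g\<close> (convolution)
  is an eigenvector of convolution by \<open>g\<close> for a nonzero eigenvalue, and that eigenvalue is a
  Fourier coefficient of \<open>g\<close> (\<open>fourier_nonzero\<close>). Convolution with continuous functions and
  regularity of the measure carry this over to \<open>L\<^sup>2\<close>.
\<close>

section \<open>Square-integrable functions\<close>

lemma borel_measurable_cnj [measurable (raw)]:
  "f \<in> borel_measurable m \<Longrightarrow> (\<lambda>x. cnj (f x)) \<in> borel_measurable m"
  by (rule borel_measurable_continuous_on[OF continuous_on_cnj[OF continuous_on_id]])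

lemma L2_measurable: "f \<in> L2 m \<Longrightarrow> f \<in> borel_measurable m"
  and L2_integrable_square: "f \<in> L2 m \<Longrightarrow> integrable m (\<lambda>x. (cmod (f x))\<^sup>2)"
  by (auto simp: L2_def)

lemma norm_add_square_le: "(norm (u + v))\<^sup>2 \<le> 2 * (norm u)\<^sup>2 + 2 * (norm v)\<^sup>2"
  for u v :: "'a::real_normed_vector"
proof -
  have "(norm (u + v))\<^sup>2 \<le> (norm u + norm v)\<^sup>2"
    by (intro power_mono norm_triangle_ineq) auto
  also have "\<dots> \<le> 2 * (norm u)\<^sup>2 + 2 * (norm v)\<^sup>2"
    using sum_squares_bound[of "norm u" "norm v"] by (simp add: power2_sum)
  finally show ?thesis .
qed

lemma L2_zero: "(\<lambda>x. 0) \<in> L2 m"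
  by (simp add: L2_def)

lemma L2_add:
  assumes "f \<in> L2 m" "g \<in> L2 m" shows "(\<lambda>x. f x + g x) \<in> L2 m"
proof -
  have [measurable]: "f \<in> borel_measurable m" "g \<in> borel_measurable m"
    using assms by (auto simp: L2_def)
  have "integrable m (\<lambda>x. (cmod (f x + g x))\<^sup>2)"
  proof (rule Bochner_Integration.integrable_bound)
    show "integrable m (\<lambda>x. 2 * (cmod (f x))\<^sup>2 + 2 * (cmod (g x))\<^sup>2)"
      using assms by (auto simp: L2_def)
  qed (use norm_add_square_le in auto)
  then show ?thesis by (simp add: L2_def)
qed

lemma L2_scale:
  assumes "f \<in> L2 m" shows "(\<lambda>x. c * f x) \<in> L2 m"
  using assms by (auto simp: L2_def norm_mult power_mult_distrib)

lemma L2_diff: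
  assumes "f \<in> L2 m" "g \<in> L2 m" shows "(\<lambda>x. f x - g x) \<in> L2 m"
  using L2_add[OF assms(1) L2_scale[OF assms(2), of "-1"]] by simp

lemma L2_sum:
  assumes "\<And>i. i \<in> I \<Longrightarrow> f i \<in> L2 m" shows "(\<lambda>x. \<Sum>i\<in>I. f i x) \<in> L2 m"
proof (cases "finite I")
  case True
  then show ?thesis using assms
    by (induction I) (auto simp: L2_zero L2_add)
qed (simp add: L2_zero)

lemma L2_inner_integrable:
  assumes "f \<in> L2 m" "g \<in> L2 m" shows "integrable m (\<lambda>x. f x * cnj (g x))"
proof (rule Bochner_Integration.integrable_bound)
  have [measurable]: "f \<in> borel_measurable m" "g \<in> borel_measurable m"
    using assms by (auto simp: L2_def)
  show "integrable m (\<lambda>x. (cmod (f x))\<^sup>2 + (cmod (g x))\<^sup>2)"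
    using assms by (auto simp: L2_def)
  show "(\<lambda>x. f x * cnj (g x)) \<in> borel_measurable m" by measurable
  show "AE x in m. norm (f x * cnj (g x)) \<le> norm ((cmod (f x))\<^sup>2 + (cmod (g x))\<^sup>2)"
  proof (rule AE_I2)
    fix x
    have "2 * (cmod (f x) * cmod (g x)) \<le> (cmod (f x))\<^sup>2 + (cmod (g x))\<^sup>2"
      using sum_squares_bound[of "cmod (f x)" "cmod (g x)"] by simp
    moreover have "0 \<le> cmod (f x) * cmod (g x)" by simp
    ultimately have "cmod (f x) * cmod (g x) \<le> (cmod (f x))\<^sup>2 + (cmod (g x))\<^sup>2"
      by linarith
    then show "norm (f x * cnj (g x)) \<le> norm ((cmod (f x))\<^sup>2 + (cmod (g x))\<^sup>2)"
      by (simp add: norm_mult)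
  qed
qed

lemma L2_inner_add_left:
  assumes "f \<in> L2 m" "g \<in> L2 m" "h \<in> L2 m"
  shows "L2_inner m (\<lambda>x. f x + g x) h = L2_inner m f h + L2_inner m g h"
  unfolding L2_inner_def using assms by (simp add: ring_distribs L2_inner_integrable)

lemma L2_inner_diff_left:
  assumes "f \<in> L2 m" "g \<in> L2 m" "h \<in> L2 m"
  shows "L2_inner m (\<lambda>x. f x - g x) h = L2_inner m f h - L2_inner m g h"
  unfolding L2_inner_def using assms by (simp add: ring_distribs L2_inner_integrable)

lemma L2_inner_scale_left:
  "L2_inner m (\<lambda>x. c * f x) h = c * L2_inner m f h"
  unfolding L2_inner_def by (simp add: mult.assoc)

lemma L2_inner_sum_left:
  assumes "\<And>i. i \<in> I \<Longrightarrow> f i \<in> L2 m" "h \<in> L2 m"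
  shows "L2_inner m (\<lambda>x. \<Sum>i\<in>I. f i x) h = (\<Sum>i\<in>I. L2_inner m (f i) h)"
  unfolding L2_inner_def using assms
  by (simp add: sum_distrib_right Bochner_Integration.integral_sum L2_inner_integrable)

lemma L2_inner_cnj: "L2_inner m g f = cnj (L2_inner m f g)"
  unfolding L2_inner_def by (subst Bochner_Integration.integral_cnj[symmetric]) (simp add: mult.commute)

lemma L2_inner_cong_AE:
  assumes "L2_eq m f f'" "f \<in> L2 m" "f' \<in> L2 m" "h \<in> L2 m"
  shows "L2_inner m f h = L2_inner m f' h"
proof -
  have [measurable]: "f \<in> borel_measurable m" "f' \<in> borel_measurable m" "h \<in> borel_measurable m"
    using assms by (auto simp: L2_def)
  show ?thesis unfolding L2_inner_def using assms(1)
    by (intro integral_cong_AE) (auto simp: L2_eq_def)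
qed

lemma L2_norm_nonneg [simp]: "0 \<le> L2_norm m f"
  by (simp add: L2_norm_def)

lemma L2_norm_square: "(L2_norm m f)\<^sup>2 = (LINT x|m. (cmod (f x))\<^sup>2)"
  by (simp add: L2_norm_def)

lemma L2_inner_self: "L2_inner m f f = of_real ((L2_norm m f)\<^sup>2)"
  unfolding L2_inner_def L2_norm_square complex_norm_square[symmetric] by (rule integral_complex_of_real)

lemma L2_norm_scale: "L2_norm m (\<lambda>x. c * f x) = cmod c * L2_norm m f"
  by (simp add: L2_norm_def norm_mult power_mult_distrib real_sqrt_mult)

lemma L2_norm_cong_AE:
  assumes "L2_eq m f f'" "f \<in> L2 m" "f' \<in> L2 m"
  shows "L2_norm m f = L2_norm m f'"
proof -
  have [measurable]: "f \<in> borel_measurable m" "f' \<in> borel_measurable m"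
    using assms by (auto simp: L2_def)
  have "(LINT x|m. (cmod (f x))\<^sup>2) = (LINT x|m. (cmod (f' x))\<^sup>2)"
    using assms(1) by (intro integral_cong_AE) (auto simp: L2_eq_def)
  then show ?thesis unfolding L2_norm_def by simp
qed

lemma L2_norm_eq_0_iff:
  assumes "f \<in> L2 m" shows "L2_norm m f = 0 \<longleftrightarrow> (AE x in m. f x = 0)"
  using integral_nonneg_eq_0_iff_AE[OF L2_integrable_square[OF assms]] by (simp add: L2_norm_def)

lemma L2_norm_diff_square:
  assumes "f \<in> L2 m" "g \<in> L2 m"
  shows "(L2_norm m (\<lambda>x. f x - g x))\<^sup>2 = (L2_norm m f)\<^sup>2 - 2 * Re (L2_inner m f g) + (L2_norm m g)\<^sup>2"
proof -
  have "of_real ((L2_norm m (\<lambda>x. f x - g x))\<^sup>2) = L2_inner m (\<lambda>x. f x - g x) (\<lambda>x. f x - g x)"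
    by (rule L2_inner_self[symmetric])
  also have "\<dots> = L2_inner m f f - L2_inner m f g - (L2_inner m g f - L2_inner m g g)"
  proof -
    have "L2_inner m h (\<lambda>x. f x - g x) = L2_inner m h f - L2_inner m h g" if "h \<in> L2 m" for h
      using L2_inner_diff_left[OF assms that]
      by (metis L2_inner_cnj complex_cnj_diff)
    then show ?thesis using assms by (simp add: L2_inner_diff_left L2_diff)
  qed
  finally have "Re (of_real ((L2_norm m (\<lambda>x. f x - g x))\<^sup>2)) =
     Re (L2_inner m f f - L2_inner m f g - (cnj (L2_inner m f g) - L2_inner m g g))"
    using L2_inner_cnj[of m g f] by simp
  then show ?thesis by (simp add: L2_inner_self)
qed

lemma L2_Cauchy_Schwarz:
  assumes "f \<in> L2 m" "g \<in> L2 m"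
  shows "cmod (L2_inner m f g) \<le> L2_norm m f * L2_norm m g"
proof -
  \<comment> \<open>The quadratic polynomial \<open>quad\<close> in \<open>t\<close> is \<open>\<parallel>f - t z g\<parallel>\<^sup>2\<close>; it is evaluated at its minimum
    \<open>t = 1 / G\<close>, or at a large \<open>t\<close> if \<open>G = 0\<close>.\<close>
  define z where "z = L2_inner m f g"
  define F G where "F = (L2_norm m f)\<^sup>2" and "G = (L2_norm m g)\<^sup>2"
  have quad: "0 \<le> F - 2 * t * (cmod z)\<^sup>2 + t\<^sup>2 * (cmod z)\<^sup>2 * G" for t :: real
  proof -
    let ?c = "of_real t * z"
    have *: "L2_inner m f (\<lambda>x. ?c * g x) = cnj ?c * z"
      unfolding z_def by (subst L2_inner_cnj) (simp add: L2_inner_scale_left L2_inner_cnj[of m g f])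
    have "0 \<le> (L2_norm m (\<lambda>x. f x - ?c * g x))\<^sup>2" by simp
    also have "\<dots> = F - 2 * Re (cnj ?c * z) + (cmod ?c)\<^sup>2 * G"
      using assms by (subst L2_norm_diff_square) (auto simp: L2_scale * F_def G_def L2_norm_scale power_mult_distrib)
    also have "cnj ?c * z = of_real (t * (cmod z)\<^sup>2)"
      using complex_norm_square[of z] by (simp add: mult_ac)
    finally show ?thesis by (simp add: norm_mult power_mult_distrib algebra_simps)
  qed
  have "(cmod z)\<^sup>2 \<le> F * G"
  proof (cases "G = 0")
    case True
    have "(cmod z)\<^sup>2 \<le> 0"
    proof (rule ccontr)
      assume "\<not> (cmod z)\<^sup>2 \<le> 0"
      moreover have "0 \<le> F" by (simp add: F_def)
      ultimately show False using quad[of "(F + 1) / (cmod z)\<^sup>2"] True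
        by simp
    qed
    then show ?thesis using True by simp
  next
    case False
    then have "G > 0" by (simp add: G_def)
    then show ?thesis using quad[of "1 / G"]
      by (simp add: field_simps power2_eq_square)
  qed
  then show ?thesis
    unfolding z_def F_def G_def power_mult_distrib[symmetric] by (rule power2_le_imp_le) simp
qed

text \<open>
  Stated for a difference, the form in which approximation errors appear.
\<close>

lemma L2_norm_triangle:
  assumes "f \<in> L2 m" "g \<in> L2 m"
  shows "L2_norm m (\<lambda>x. f x - g x) \<le> L2_norm m f + L2_norm m g"
proof (rule power2_le_imp_le)
  have "- Re (L2_inner m f g) \<le> L2_norm m f * L2_norm m g"
    using L2_Cauchy_Schwarz[OF assms] abs_Re_le_cmod[of "L2_inner m f g"] by linarith
  then show "(L2_norm m (\<lambda>x. f x - g x))\<^sup>2 \<le> (L2_norm m f + L2_norm m g)\<^sup>2"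
    by (simp add: L2_norm_diff_square[OF assms] power2_sum)
qed simp

section \<open>Continuous functions on a compact group\<close>

locale compact_haar_group = prob_space m
  for m :: "'g::{topological_ab_group_add, t2_space} measure" +
  assumes compact_UNIV: "compact (UNIV :: 'g set)"
    and haar: "normalized_haar m"
begin

lemma sets_haar [measurable_cong, simp]: "sets m = sets borel"
  using haar by (simp add: normalized_haar_def)

lemma space_haar [simp]: "space m = UNIV"
  using sets_eq_imp_space_eq[OF sets_haar] by simp

lemma measurable_haar: "borel_measurable m = borel_measurable borel"
  by (rule measurable_cong_sets) auto

lemma continuous_measurable:
  fixes f :: "'g \<Rightarrow> 'b::topological_space"
  shows "continuous_on UNIV f \<Longrightarrow> f \<in> borel_measurable m"
  by (simp add: measurable_haar borel_measurable_continuous_onI)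

lemma continuous_bounded:
  fixes f :: "'g \<Rightarrow> 'b::real_normed_vector"
  assumes "continuous_on UNIV f" obtains M where "M > 0" "\<And>x. norm (f x) \<le> M"
proof -
  have "compact (f ` UNIV)" using compact_continuous_image[OF assms compact_UNIV] .
  then have "bounded (f ` UNIV)" by (rule compact_imp_bounded)
  then show ?thesis using that by (auto simp: bounded_pos)
qed

lemma continuous_integrable:
  fixes f :: "'g \<Rightarrow> 'b::{banach, second_countable_topology}"
  assumes "continuous_on UNIV f" shows "integrable m f"
proof -
  obtain M where "\<And>x. norm (f x) \<le> M" using continuous_bounded[OF assms] by blast
  then show ?thesis using continuous_measurable[OF assms]
    by (intro integrable_const_bound[of _ M]) auto
qed

lemma continuous_L2: "continuous_on UNIV f \<Longrightarrow> f \<in> L2 m"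
  unfolding L2_def by (auto intro!: continuous_measurable continuous_integrable continuous_intros)

lemma continuous_translate:
  assumes "continuous_on UNIV f"
  shows "continuous_on UNIV (\<lambda>x::'g. f (x - y))" "continuous_on UNIV (\<lambda>x::'g. f (y - x))"
    "continuous_on UNIV (\<lambda>x::'g. f (- x))" "continuous_on UNIV (\<lambda>x::'g. f (x + y))"
    "continuous_on UNIV (\<lambda>x::'g. f (y + x))"
  by (auto intro!: continuous_on_compose2[OF assms] continuous_intros)

lemma integral_translate:
  fixes f :: "'g \<Rightarrow> 'b::{banach, second_countable_topology}"
  assumes "f \<in> borel_measurable m"
  shows "(LINT x|m. f (y + x)) = (LINT x|m. f x)"
proof -
  have plus: "(+) y \<in> measurable m borel"
    by (intro continuous_measurable continuous_intros)
  have "distr m borel ((+) y) = m" using haar by (simp add: normalized_haar_def)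
  then have "(LINT x|m. f x) = (LINT x|distr m borel ((+) y). f x)" by simp
  also have "\<dots> = (LINT x|m. f (y + x))"
    using assms by (intro integral_distr plus) (simp add: measurable_haar)
  finally show ?thesis by simp
qed

text \<open>
  The group carries no metric, so uniform continuity is phrased with a neighbourhood of \<open>0\<close>. It
  comes from compactness through the tube lemma, applied to \<open>(u, x) \<mapsto> f (u + x)\<close> near
  \<open>u = 0\<close>.
\<close>

lemma uniformly_continuous_group:
  fixes f :: "'g \<Rightarrow> 'b::metric_space"
  assumes "continuous_on UNIV f" "e > 0"
  obtains U where "open U" "0 \<in> U" "\<And>x u. u \<in> U \<Longrightarrow> dist (f (u + x)) (f x) \<le> e"
proof -
  have "continuous_on (UNIV \<times> UNIV) (\<lambda>p. f (fst p + snd p))"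
    by (intro continuous_on_compose2[OF assms(1)] continuous_intros) simp
  from continuous_on_prod_compactE[OF this compact_UNIV _ assms(2), of 0]
  obtain U where "0 \<in> U" "open U" "\<forall>u\<in>U. \<forall>x. dist (f (u + x)) (f x) \<le> e"
    by (simp, blast)
  then show ?thesis using that by blast
qed

lemma finite_cover_translates:
  fixes U :: "'g set"
  assumes "open U" "0 \<in> U"
  obtains T where "finite T" "\<And>x. \<exists>t\<in>T. x - t \<in> U"
proof -
  have "open ((\<lambda>x. x - t) -` U)" for t :: 'g
    by (intro open_vimage assms continuous_intros)
  moreover have "UNIV \<subseteq> (\<Union>t\<in>UNIV. (\<lambda>x. x - t) -` U)" using assms by auto
  ultimately obtain T where "finite T" "UNIV \<subseteq> (\<Union>t\<in>T. (\<lambda>x. x - t) -` U)"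
    by (meson compactE_image[OF compact_UNIV])
  then show ?thesis using that by blast
qed

text \<open>
  Finitely many translates of a nonempty open set cover the compact group, and they all have the
  same measure.
\<close>

lemma open_positive:
  assumes "open U" "U \<noteq> {}" shows "measure m U > 0"
proof (rule ccontr)
  assume "\<not> measure m U > 0"
  then have U0: "measure m U = 0" by (simp add: zero_less_measure_iff)
  obtain u where u: "u \<in> U" using assms by auto
  have "open ((\<lambda>x. x + u) -` U)" by (intro open_vimage assms continuous_intros)
  moreover have "0 \<in> (\<lambda>x. x + u) -` U" using u by simp
  ultimately obtain T where T: "finite T" "\<And>x. \<exists>t\<in>T. x - t \<in> (\<lambda>x. x + u) -` U"
    by (rule finite_cover_translates) blast
  have null: "measure m ((\<lambda>x. x - t + u) -` U) = 0" for t
  proof -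
    have meas: "(\<lambda>x. x - t + u) \<in> measurable m borel"
      by (intro continuous_measurable continuous_intros)
    have "distr m borel ((+) (u - t)) = m" using haar by (simp add: normalized_haar_def)
    then have "0 = measure (distr m borel ((+) (u - t))) U" using U0 by simp
    also have "\<dots> = measure m ((+) (u - t) -` U \<inter> space m)"
      using assms by (intro measure_distr continuous_measurable continuous_intros) auto
    also have "(+) (u - t) = (\<lambda>x. x - t + u)" by (auto simp: algebra_simps)
    finally show ?thesis by simp
  qed
  have "1 = measure m (\<Union>t\<in>T. (\<lambda>x. x - t + u) -` U)"
  proof -
    have "(\<Union>t\<in>T. (\<lambda>x. x - t + u) -` U) = space m" using T by fastforce
    then show ?thesis using prob_space by simp
  qed
  also have "\<dots> \<le> (\<Sum>t\<in>T. measure m ((\<lambda>x. x - t + u) -` U))"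
  proof (rule finite_measure_subadditive_finite)
    show "(\<lambda>t. (\<lambda>x. x - t + u) -` U) ` T \<subseteq> sets m"
      by (auto intro!: borel_open open_vimage assms continuous_intros)
  qed (fact T)
  also have "\<dots> = 0" by (simp add: null)
  finally show False by simp
qed

lemma continuous_AE_zero:
  fixes f :: "'g \<Rightarrow> complex"
  assumes "continuous_on UNIV f" "AE x in m. f x = 0" shows "f x = 0"
proof (rule ccontr)
  assume "f x \<noteq> 0"
  let ?U = "f -` (- {0})"
  have U: "open ?U" by (intro open_vimage assms) auto
  then have "measure m ?U > 0" using \<open>f x \<noteq> 0\<close> by (intro open_positive) auto
  moreover have "measure m ?U = 0"
  proof -
    have "AE y in m. y \<notin> ?U" using assms(2) by auto
    then have "?U \<in> null_sets m"
      using U by (subst AE_iff_null_sets) auto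
    then show ?thesis by (simp add: null_sets_def measure_def)
  qed
  ultimately show False by simp
qed

lemma continuous_L2_norm_eq_0:
  assumes "continuous_on UNIV f" "L2_norm m f = 0" shows "f x = 0"
  using assms continuous_AE_zero L2_norm_eq_0_iff[OF continuous_L2] by blast

text \<open>
  Without second countability the Borel sets of the product space need not belong to the product
  \<open>\<sigma>\<close>-algebra, so continuity of the kernel alone does not give measurability. Uniform
  continuity does: the kernel is a uniform limit of functions that are constant in \<open>x\<close> on
  each cell of a finite partition of the group. Fubini's theorem for convolutions depends on it.
\<close>

lemma diff_kernel_measurable:
  assumes f: "continuous_on UNIV f"
  shows "(\<lambda>(x, y). f (x - y) :: complex) \<in> borel_measurable (m \<Otimes>\<^sub>M m)"
proof -
  have "\<exists>h. h \<in> borel_measurable (m \<Otimes>\<^sub>M m) \<and> (\<forall>x y. dist (h (x, y)) (f (x - y)) \<le> 1 / real (Suc n))"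
    for n
  proof -
    obtain U where U: "open U" "0 \<in> U" "\<And>x u. u \<in> U \<Longrightarrow> dist (f (u + x)) (f x) \<le> 1 / real (Suc n)"
      by (rule uniformly_continuous_group[OF f, of "1 / real (Suc n)"]) auto
    obtain T where T: "finite T" "\<And>x. \<exists>t\<in>T. x - t \<in> U"
      using finite_cover_translates[OF U(1,2)] by blast
    obtain ts where ts: "set ts = T" using finite_list[OF T(1)] by blast
    have cell_meas: "{x. x - t \<in> U} \<in> sets m" for t
    proof -
      have "open ((\<lambda>x. x - t) -` U)" by (intro open_vimage U continuous_intros)
      then show ?thesis by (simp add: vimage_def)
    qed
    \<comment> \<open>\<open>find\<close> picks the first translate that contains \<open>x\<close>, which turns the cover into a partition.\<close>
    define h where "h = (\<lambda>ts (x, y). case find (\<lambda>t. x - t \<in> U) ts of None \<Rightarrow> 0 | Some t \<Rightarrow> f (t - y))"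
    have "h ts \<in> borel_measurable (m \<Otimes>\<^sub>M m)" for ts
    proof (induction ts)
      case (Cons t ts)
      have [measurable]: "(\<lambda>y. f (t - y)) \<in> borel_measurable m"
        by (intro continuous_measurable continuous_translate f)
      have [measurable]: "{x. x - t \<in> U} \<in> sets m" by (rule cell_meas)
      have "h (t # ts) = (\<lambda>p. if fst p \<in> {x. x - t \<in> U} then f (t - snd p) else h ts p)"
        by (auto simp: h_def fun_eq_iff)
      also have "\<dots> \<in> borel_measurable (m \<Otimes>\<^sub>M m)"
        using Cons by measurable
      finally show ?case .
    qed (simp add: h_def)
    moreover have "dist (h ts (x, y)) (f (x - y)) \<le> 1 / real (Suc n)" for x y
    proof -
      obtain t where t: "find (\<lambda>t. x - t \<in> U) ts = Some t"
        using T(2)[of x] ts by (metis find_None_iff not_Some_eq)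
      then have "x - t \<in> U" by (auto simp: find_Some_iff)
      then have "dist (f ((x - t) + (t - y))) (f (t - y)) \<le> 1 / real (Suc n)" by (rule U(3))
      then show ?thesis using t by (simp add: h_def dist_commute)
    qed
    ultimately show ?thesis by blast
  qed
  then obtain h where h: "\<And>n. h n \<in> borel_measurable (m \<Otimes>\<^sub>M m)"
      "\<And>n x y. dist (h n (x, y)) (f (x - y)) \<le> 1 / real (Suc n)"
    by metis
  show ?thesis
  proof (rule borel_measurable_LIMSEQ_metric[OF h(1)])
    fix p
    show "(\<lambda>n. h n p) \<longlonglongrightarrow> (case p of (x, y) \<Rightarrow> f (x - y))"
    proof (cases p)
      case (Pair x y)
      show ?thesis unfolding Pair prod.case tendsto_dist_iff[of "\<lambda>n. h n (x, y)"]
        using h(2) by (intro tendsto_sandwich[OF _ _ tendsto_const LIMSEQ_inverse_real_of_nat]) (auto simp: inverse_eq_divide)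
    qed
  qed
qed

lemma Fubini_kernel:
  assumes f: "continuous_on UNIV f" and u: "integrable m u" and v: "integrable m v"
  shows "(LINT x|m. u x * (LINT y|m. f (x - y) * v y)) = (LINT y|m. (LINT x|m. u x * f (x - y)) * (v y :: complex))"
proof -
  interpret P: pair_sigma_finite m m ..
  obtain M where M: "M > 0" "\<And>x. norm (f x) \<le> M" using continuous_bounded[OF f] by blast
  note [measurable] = diff_kernel_measurable[OF f]
  have [measurable]: "u \<in> borel_measurable m" "v \<in> borel_measurable m" using u v by auto
  have fxy: "(\<lambda>y. f (x - y)) \<in> borel_measurable m" "(\<lambda>x. f (x - y)) \<in> borel_measurable m" for x y
    by (intro continuous_measurable continuous_translate f)+
  have meas: "(\<lambda>p. u (fst p) * (case p of (x, y) \<Rightarrow> f (x - y)) * v (snd p)) \<in> borel_measurable (m \<Otimes>\<^sub>M m)"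
    by measurable
  have bound: "norm (u x * f (x - y) * v y) \<le> norm (M * norm (u x) * norm (v y))" for x y
    using mult_right_mono[OF mult_left_mono[OF M(2)[of "x - y"], of "norm (u x)"], of "norm (v y)"] M(1)
    by (simp add: norm_mult abs_mult mult_ac)
  have int1: "integrable m (\<lambda>y. u x * f (x - y) * v y)" for x
  proof (rule Bochner_Integration.integrable_bound)
    show "integrable m (\<lambda>y. M * norm (u x) * norm (v y))" using v by simp
    show "(\<lambda>y. u x * f (x - y) * v y) \<in> borel_measurable m" using fxy by measurable
  qed (use bound in auto)
  have "integrable (m \<Otimes>\<^sub>M m) (\<lambda>p. u (fst p) * (case p of (x, y) \<Rightarrow> f (x - y)) * v (snd p))"
  proof (rule P.Fubini_integrable[OF meas])
    show "integrable m (\<lambda>x. LINT y|m. norm (u (fst (x, y)) * (case (x, y) of (x, y) \<Rightarrow> f (x - y)) * v (snd (x, y))))"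
    proof (rule Bochner_Integration.integrable_bound)
      show "integrable m (\<lambda>x. M * norm (u x) * (LINT y|m. norm (v y)))" using u by simp
      show "(\<lambda>x. LINT y|m. norm (u (fst (x, y)) * (case (x, y) of (x, y) \<Rightarrow> f (x - y)) * v (snd (x, y)))) \<in> borel_measurable m"
        using meas by measurable
      show "AE x in m. norm (LINT y|m. norm (u (fst (x, y)) * (case (x, y) of (x, y) \<Rightarrow> f (x - y)) * v (snd (x, y))))
          \<le> norm (M * norm (u x) * (LINT y|m. norm (v y)))"
      proof (rule AE_I2)
        fix x
        have "(LINT y|m. norm (u x * f (x - y) * v y)) \<le> (LINT y|m. M * norm (u x) * norm (v y))"
          using bound v M(1) int1 by (intro integral_mono) (auto simp: abs_mult)
        then show "norm (LINT y|m. norm (u (fst (x, y)) * (case (x, y) of (x, y) \<Rightarrow> f (x - y)) * v (snd (x, y))))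
          \<le> norm (M * norm (u x) * (LINT y|m. norm (v y)))"
          using M(1) by (simp add: abs_mult)
      qed
    qed
  qed (use int1 in simp)
  then have "integrable (m \<Otimes>\<^sub>M m) (\<lambda>(x, y). u x * f (x - y) * v y)"
    by (simp add: split_beta')
  from P.Fubini_integral[OF this]
  have "(LINT y|m. (LINT x|m. u x * f (x - y)) * v y) = (LINT x|m. LINT y|m. u x * f (x - y) * v y)"
    by simp
  then show ?thesis by (simp add: mult.assoc)
qed

text \<open>
  Invariance under inversion follows from invariance under translation: integrate \<open>f (x - y)\<close>
  over both variables in both orders.
\<close>

lemma integral_uminus:
  fixes f :: "'g \<Rightarrow> complex"
  assumes f: "continuous_on UNIV f"
  shows "(LINT x|m. f (- x)) = (LINT x|m. f x)"
proof -
  have "(LINT y|m. f (x - y)) = (LINT y|m. f (- y))" for x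
    using integral_translate[of "\<lambda>y. f (x - y)" x] f
    by (simp add: continuous_measurable continuous_translate)
  moreover have "(LINT x|m. f (x - y)) = (LINT x|m. f x)" for y
    using integral_translate[of f "- y"] f by (simp add: continuous_measurable)
  ultimately show ?thesis
    using Fubini_kernel[OF f, of "\<lambda>x. 1" "\<lambda>x. 1"] prob_space by simp
qed

end

section \<open>Convolution\<close>

context compact_haar_group
begin

definition conv :: "('g \<Rightarrow> complex) \<Rightarrow> ('g \<Rightarrow> complex) \<Rightarrow> 'g \<Rightarrow> complex" where
  "conv f g x = (LINT y|m. f (x - y) * g y)"

text \<open>
  The adjoint: convolution by \<open>star f\<close> is the Hilbert space adjoint of convolution by \<open>f\<close>.
\<close>

definition star :: "('g \<Rightarrow> complex) \<Rightarrow> 'g \<Rightarrow> complex" where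
  "star f x = cnj (f (- x))"

lemma conv_integrable:
  fixes f g :: "'g \<Rightarrow> complex"
  assumes f: "continuous_on UNIV f" and g: "integrable m g"
  shows "integrable m (\<lambda>y. f (x - y) * g y)"
proof -
  obtain M where M: "M > 0" "\<And>x. norm (f x) \<le> M" using continuous_bounded[OF f] by blast
  have [measurable]: "(\<lambda>y. f (x - y)) \<in> borel_measurable m"
    by (intro continuous_measurable continuous_translate f)
  have [measurable]: "g \<in> borel_measurable m" using g by auto
  show ?thesis
  proof (rule Bochner_Integration.integrable_bound)
    show "integrable m (\<lambda>y. M * norm (g y))" using g by simp
    show "(\<lambda>y. f (x - y) * g y) \<in> borel_measurable m" by measurable
  qed (use M in \<open>auto simp: norm_mult abs_mult intro!: mult_right_mono\<close>)
qed

text \<open>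
  Convolution with a continuous function smooths any integrable \<open>g\<close>. This is the bridge from
  continuous functions to \<open>L\<^sup>2\<close> in the completeness proof.
\<close>

lemma continuous_conv:
  assumes f: "continuous_on UNIV f" and g: "integrable m g"
  shows "continuous_on UNIV (conv f g)"
proof -
  let ?I = "LINT y|m. norm (g y)"
  define J where "J = ?I + 1"
  have "J > 0" unfolding J_def by (intro add_nonneg_pos) auto
  have "(conv f g \<longlongrightarrow> conv f g x) (at x)" for x
  proof (rule tendstoI)
    fix e :: real assume "e > 0"
    define d where "d = e / (2 * J)"
    have "d > 0" using \<open>e > 0\<close> \<open>J > 0\<close> by (simp add: d_def)
    obtain U where U: "open U" "0 \<in> U" "\<And>x u. u \<in> U \<Longrightarrow> dist (f (u + x)) (f x) \<le> d"
      using uniformly_continuous_group[OF f \<open>d > 0\<close>] by blast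
    have "dist (conv f g z) (conv f g x) < e" if "z - x \<in> U" for z
    proof -
      have "conv f g z - conv f g x = (LINT y|m. (f (z - y) - f (x - y)) * g y)"
        unfolding conv_def by (simp add: ring_distribs conv_integrable[OF f g])
      also have "norm \<dots> \<le> (LINT y|m. d * norm (g y))"
      proof (rule order_trans[OF integral_norm_bound integral_mono])
        show "integrable m (\<lambda>y. norm ((f (z - y) - f (x - y)) * g y))"
          by (intro integrable_norm) (simp add: ring_distribs conv_integrable[OF f g])
        show "integrable m (\<lambda>y. d * norm (g y))" using g by simp
        show "norm ((f (z - y) - f (x - y)) * g y) \<le> d * norm (g y)" for y
          using U(3)[OF that, of "x - y"] by (auto simp: norm_mult dist_norm intro!: mult_right_mono)
      qed
      also have "\<dots> = d * ?I" by simp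
      also have "\<dots> \<le> d * J" using \<open>d > 0\<close> by (simp add: J_def)
      also have "\<dots> = e / 2" using \<open>J > 0\<close> by (simp add: d_def)
      also have "\<dots> < e" using \<open>e > 0\<close> by simp
      finally show ?thesis by (simp add: dist_norm)
    qed
    moreover have "open ((\<lambda>z. z - x) -` U)" by (intro open_vimage U continuous_intros)
    ultimately show "\<forall>\<^sub>F z in at x. dist (conv f g z) (conv f g x) < e"
      unfolding eventually_at_topological using U(2) by (intro exI[of _ "(\<lambda>z. z - x) -` U"]) auto
  qed
  then show ?thesis by (simp add: continuous_on_def)
qed

lemma continuous_conv':
  "continuous_on UNIV f \<Longrightarrow> continuous_on UNIV g \<Longrightarrow> continuous_on UNIV (conv f g)"
  by (simp add: continuous_conv continuous_integrable)

lemma continuous_star: "continuous_on UNIV f \<Longrightarrow> continuous_on UNIV (star f)"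
  unfolding star_def by (intro continuous_intros continuous_translate)

lemma star_star [simp]: "star (star f) = f"
  by (simp add: star_def fun_eq_iff)

lemma conv_commute:
  assumes f: "continuous_on UNIV f" and g: "continuous_on UNIV g"
  shows "conv f g = conv g f"
proof
  fix x
  let ?h = "\<lambda>y. f (x - y) * g y"
  have h: "continuous_on UNIV ?h" by (intro continuous_intros continuous_translate f g)
  have "conv f g x = (LINT y|m. ?h (- y))"
    unfolding conv_def by (rule integral_uminus[OF h, symmetric])
  also have "\<dots> = (LINT y|m. ?h (- (- x + y)))"
    using integral_translate[OF continuous_measurable[OF continuous_translate(3)[OF h]], of "- x"] by simp
  also have "\<dots> = conv g f x"
    unfolding conv_def by (simp add: mult.commute)
  finally show "conv f g x = conv g f x" .
qed

lemma conv_assoc: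
  assumes f: "continuous_on UNIV f" and g: "continuous_on UNIV g" and h: "integrable m h"
  shows "conv (conv f g) h = conv f (conv g h)"
proof
  fix x
  have "conv f (conv g h) x = (LINT z|m. f (x - z) * (LINT y|m. g (z - y) * h y))"
    by (simp add: conv_def)
  also have "\<dots> = (LINT y|m. (LINT z|m. f (x - z) * g (z - y)) * h y)"
    by (intro Fubini_kernel g h continuous_integrable continuous_translate f)
  also have "(\<lambda>y. LINT z|m. f (x - z) * g (z - y)) = (\<lambda>y. conv f g (x - y))"
  proof
    fix y
    have "(LINT z|m. f (x - z) * g (z - y)) = (LINT z|m. f (x - (y + z)) * g ((y + z) - y))"
      by (intro integral_translate[symmetric] continuous_measurable continuous_intros continuous_translate f g)
    then show "(LINT z|m. f (x - z) * g (z - y)) = conv f g (x - y)"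
      by (simp add: conv_def algebra_simps)
  qed
  finally show "conv (conv f g) h x = conv f (conv g h) x" by (simp add: conv_def)
qed

lemma conv_add_right:
  assumes "continuous_on UNIV f" "continuous_on UNIV g" "continuous_on UNIV h"
  shows "conv f (\<lambda>x. g x + h x) = (\<lambda>x. conv f g x + conv f h x)"
  unfolding conv_def fun_eq_iff
  using assms by (simp add: ring_distribs conv_integrable continuous_integrable)

lemma conv_scale_right: "conv f (\<lambda>x. c * g x) = (\<lambda>x. c * conv f g x)"
  unfolding conv_def fun_eq_iff by (simp add: mult.left_commute)

lemma conv_scale_left: "conv (\<lambda>x. c * f x) g = (\<lambda>x. c * conv f g x)"
  unfolding conv_def fun_eq_iff by (simp add: mult.assoc)

lemma conv_diff_right:
  assumes "continuous_on UNIV f" "continuous_on UNIV g" "continuous_on UNIV h"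
  shows "conv f (\<lambda>x. g x - h x) = (\<lambda>x. conv f g x - conv f h x)"
  unfolding conv_def fun_eq_iff
  using assms by (simp add: ring_distribs conv_integrable continuous_integrable)

lemma star_conv:
  assumes f: "continuous_on UNIV f" and g: "continuous_on UNIV g"
  shows "star (conv f g) = conv (star f) (star g)"
proof
  fix x
  let ?h = "\<lambda>y. cnj (f (- x - y) * g y)"
  have h: "continuous_on UNIV ?h" by (intro continuous_intros continuous_translate f g)
  have "star (conv f g) x = (LINT y|m. ?h y)"
    unfolding star_def conv_def by (rule Bochner_Integration.integral_cnj[symmetric])
  also have "\<dots> = (LINT y|m. ?h (- y))"
    by (rule integral_uminus[OF h, symmetric])
  also have "\<dots> = conv (star f) (star g) x"
    by (simp add: star_def conv_def)
  finally show "star (conv f g) x = conv (star f) (star g) x" .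
qed

lemma L2_inner_conv:
  assumes f: "continuous_on UNIV f" and g: "continuous_on UNIV g"
  shows "L2_inner m f g = conv f (star g) 0"
proof -
  have "continuous_on UNIV (\<lambda>x. f x * cnj (g x))" by (intro continuous_intros f g)
  from integral_uminus[OF this] show ?thesis
    by (simp add: L2_inner_def conv_def star_def)
qed

lemma conv_star_0:
  assumes "continuous_on UNIV f"
  shows "conv f (star f) 0 = of_real ((L2_norm m f)\<^sup>2)"
  using L2_inner_conv[OF assms assms] by (simp add: L2_inner_self)

text \<open>
  Up to conjugation, \<open>conv f g x\<close> is the inner product of \<open>g\<close> with a reflected translate of
  \<open>f\<close>, which has the same norm as \<open>f\<close>. Convolution thus turns \<open>L\<^sup>2\<close>-convergence into uniform
  convergence.
\<close>

lemma conv_bound: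
  assumes f: "continuous_on UNIV f" and g: "continuous_on UNIV g"
  shows "cmod (conv f g x) \<le> L2_norm m f * L2_norm m g"
proof -
  let ?f = "\<lambda>y. cnj (f (x - y))"
  have cf: "continuous_on UNIV ?f" by (intro continuous_intros continuous_translate f)
  have "(LINT y|m. of_real ((cmod (f (x - y)))\<^sup>2) :: complex) = (LINT y|m. of_real ((cmod (f y))\<^sup>2))"
  proof -
    have h: "continuous_on UNIV (\<lambda>y. of_real ((cmod (f y))\<^sup>2) :: complex)"
      by (intro continuous_intros f)
    show ?thesis
      using integral_translate[OF continuous_measurable[OF continuous_translate(3)[OF h]], of "- x"]
        integral_uminus[OF h] by simp
  qed
  then have "L2_norm m ?f = L2_norm m f"
    by (simp add: L2_norm_def flip: of_real_power)
  moreover have "conv f g x = L2_inner m g ?f"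
    by (simp add: conv_def L2_inner_def mult.commute)
  ultimately show ?thesis
    using L2_Cauchy_Schwarz[OF continuous_L2[OF g] continuous_L2[OF cf]] by (simp add: mult.commute)
qed

lemma L2_norm_le_bound:
  assumes f: "continuous_on UNIV f" and "\<And>x. cmod (f x) \<le> e"
  shows "L2_norm m f \<le> e"
proof -
  have "0 \<le> e" using assms(2)[of 0] norm_ge_zero order_trans by blast
  have "(LINT x|m. (cmod (f x))\<^sup>2) \<le> (LINT x|m. e\<^sup>2)"
    using assms(2) by (intro integral_mono continuous_integrable continuous_intros f power_mono) auto
  then have "(L2_norm m f)\<^sup>2 \<le> e\<^sup>2" using prob_space by (simp add: L2_norm_square)
  then show ?thesis using \<open>0 \<le> e\<close> by (rule power2_le_imp_le)
qed

lemma conv_uniform_limit: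
  assumes f: "continuous_on UNIV f" and P: "\<And>n. continuous_on UNIV (P n)"
    and lim: "uniform_limit UNIV P p sequentially"
  shows "(\<lambda>n. conv f (P n) x) \<longlonglongrightarrow> conv f p x"
proof (rule LIMSEQ_I)
  fix e :: real assume "e > 0"
  have p: "continuous_on UNIV p"
    by (rule uniform_limit_theorem[OF _ lim]) (auto simp: P)
  define d where "d = e / (L2_norm m f + 1)"
  have nn: "0 \<le> L2_norm m f" by simp
  have "d > 0" unfolding d_def using \<open>e > 0\<close> nn
    by (intro divide_pos_pos) linarith+
  then obtain N where N: "\<And>n x. n \<ge> N \<Longrightarrow> dist (P n x) (p x) < d"
    using lim unfolding uniform_limit_sequentially_iff by blast
  show "\<exists>N. \<forall>n\<ge>N. norm (conv f (P n) x - conv f p x) < e"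
  proof (intro exI allI impI)
    fix n assume "n \<ge> N"
    have c: "continuous_on UNIV (\<lambda>x. P n x - p x)" by (intro continuous_intros P p)
    have "L2_norm m (\<lambda>x. P n x - p x) \<le> d"
      using N[OF \<open>n \<ge> N\<close>] by (intro L2_norm_le_bound c) (simp add: dist_norm less_imp_le)
    then have "L2_norm m f * L2_norm m (\<lambda>x. P n x - p x) \<le> L2_norm m f * d"
      by (intro mult_left_mono) auto
    also have "\<dots> < (L2_norm m f + 1) * d" using \<open>d > 0\<close> by simp
    also have "\<dots> = e" using nn by (simp add: d_def add_nonneg_eq_0_iff)
    finally show "norm (conv f (P n) x - conv f p x) < e"
      using conv_bound[OF f c, of x] conv_diff_right[OF f P p, of n] by simp
  qed
qed

section \<open>Idempotents of the convolution algebra\<close>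

text \<open>
  The kernels of the orthogonal projections of \<open>L\<^sup>2\<close> onto nonzero finite-dimensional
  translation-invariant subspaces.
\<close>

definition hermitian_idempotent :: "('g \<Rightarrow> complex) \<Rightarrow> bool" where
  "hermitian_idempotent p \<longleftrightarrow> continuous_on UNIV p \<and> star p = p \<and> conv p p = p \<and> p \<noteq> (\<lambda>x. 0)"

text \<open>
  From \<open>p = p * star p\<close> (convolution) one gets \<open>p 0 = \<parallel>p\<parallel>\<^sup>2\<close> and \<open>\<bar>p x\<bar> \<le> \<parallel>p\<parallel>\<^sup>2\<close>. The
  uniform bound gives \<open>\<parallel>p\<parallel> \<le> \<parallel>p\<parallel>\<^sup>2\<close> on a space of total mass one, hence \<open>\<parallel>p\<parallel> \<ge> 1\<close>.
\<close>

lemma hermitian_idempotent_0: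
  assumes "hermitian_idempotent p"
  shows "p 0 = of_real ((L2_norm m p)\<^sup>2)" "1 \<le> Re (p 0)" "cmod (p x) \<le> Re (p 0)"
proof -
  have p: "continuous_on UNIV p" "star p = p" "conv p p = p" "p \<noteq> (\<lambda>x. 0)"
    using assms by (auto simp: hermitian_idempotent_def)
  show p0: "p 0 = of_real ((L2_norm m p)\<^sup>2)" using conv_star_0[OF p(1)] p by simp
  show bound: "cmod (p x) \<le> Re (p 0)" for x
    using conv_bound[OF p(1,1), of x] p0 p(3) by (simp add: power2_eq_square)
  have "L2_norm m p \<noteq> 0" using continuous_L2_norm_eq_0[OF p(1)] p(4) by auto
  then have "L2_norm m p > 0" by (simp add: less_le)
  have "L2_norm m p \<le> (L2_norm m p)\<^sup>2" using L2_norm_le_bound[OF p(1) bound] p0 by simp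
  then have "1 \<le> L2_norm m p" using \<open>L2_norm m p > 0\<close> by (simp add: power2_eq_square)
  then have "1 \<le> (L2_norm m p)\<^sup>2" by (simp add: one_le_power)
  then show "1 \<le> Re (p 0)" using p0 by simp
qed

text \<open>
  Power iteration. The sequence of rescaled powers \<open>P n\<close> is Cauchy because all its inner products
  \<open>\<langle>P i, P j\<rangle> = c (i + j + 1)\<close> come from one decreasing sequence that is bounded below; the
  lower bound \<open>1\<close> also keeps the limit from being zero. Since \<open>p\<close> is a limit
  of convolution multiples of \<open>q\<close>, everything that fixes \<open>q\<close> fixes \<open>p\<close>.
\<close>

lemma spectral_idempotent:
  assumes q: "continuous_on UNIV q" and herm: "star q = q" and nz: "q \<noteq> (\<lambda>x. 0)"
  obtains r p where "r > 0" "hermitian_idempotent p" "conv (conv q q) p = (\<lambda>x. of_real r * p x)"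
    "\<And>e. continuous_on UNIV e \<Longrightarrow> conv e q = q \<Longrightarrow> conv e p = p"
proof -
  \<comment> \<open>\<open>u n\<close> is the convolution power of \<open>q\<close> with exponent \<open>n + 1\<close>.\<close>
  define u where "u = rec_nat q (\<lambda>_. conv q)"
  have u0: "u 0 = q" and uSuc: "\<And>n. u (Suc n) = conv q (u n)" by (simp_all add: u_def)
  have u_cont: "continuous_on UNIV (u n)" for n
    by (induction n) (simp_all add: u0 uSuc q continuous_conv')
  have u_star: "star (u n) = u n" for n
    by (induction n) (simp_all add: u0 uSuc star_conv u_cont q herm)
  have u_conv: "conv (u i) (u j) = u (Suc (i + j))" for i j
    by (induction i) (simp_all add: u0 uSuc conv_assoc q u_cont continuous_integrable)
  have u_inner: "L2_inner m (u i) (u j) = u (Suc (i + j)) 0" for i j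
    by (simp add: L2_inner_conv u_cont u_star u_conv)
  define T where "T n = (L2_norm m (u n))\<^sup>2" for n
  have T_eq: "u (Suc (2 * n)) 0 = of_real (T n)" for n
    using u_inner[of n n] by (simp add: L2_inner_self T_def mult_2)
  have T_inner: "L2_inner m (u i) (u j) = of_real (T n)" if "i + j = 2 * n" for i j n
    using u_inner[of i j] that T_eq[of n] by simp
  \<comment> \<open>Cauchy-Schwarz for the powers of \<open>q\<close> with exponents \<open>n + 1\<close> and \<open>n + 3\<close>.\<close>
  have T_convex: "(T (Suc n))\<^sup>2 \<le> T n * T (Suc (Suc n))" for n
  proof -
    have "L2_inner m (u n) (u (Suc (Suc n))) = of_real (T (Suc n))" by (rule T_inner) simp
    then have "\<bar>T (Suc n)\<bar> \<le> L2_norm m (u n) * L2_norm m (u (Suc (Suc n)))"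
      using L2_Cauchy_Schwarz[OF continuous_L2[OF u_cont] continuous_L2[OF u_cont], of n "Suc (Suc n)"]
      by simp
    then have "\<bar>T (Suc n)\<bar>\<^sup>2 \<le> (L2_norm m (u n) * L2_norm m (u (Suc (Suc n))))\<^sup>2"
      by (rule power_mono) simp
    then show ?thesis by (simp add: T_def power_mult_distrib)
  qed
  have T_norm: "L2_norm m (u (Suc (2 * n))) \<le> T n" for n
  proof (rule L2_norm_le_bound[OF u_cont])
    show "cmod (u (Suc (2 * n)) x) \<le> T n" for x
      using conv_bound[OF u_cont u_cont, of n n x] by (simp add: u_conv T_def power2_eq_square mult_2)
  qed
  \<comment> \<open>For traces of positive operators this is \<open>tr (S\<^sup>i\<^sup>+\<^sup>j) \<le> tr (S\<^sup>i) tr (S\<^sup>j)\<close>; the index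
    shift in \<open>u\<close> makes it \<open>n + k + 1\<close> on the left.\<close>
  have T_submult: "T (Suc (n + k)) \<le> T n * T k" for n k
  proof -
    have "L2_inner m (u (Suc (2 * n))) (u (Suc (2 * k))) = of_real (T (Suc (n + k)))"
      by (rule T_inner) simp
    then have "T (Suc (n + k)) \<le> L2_norm m (u (Suc (2 * n))) * L2_norm m (u (Suc (2 * k)))"
      using L2_Cauchy_Schwarz[OF continuous_L2[OF u_cont] continuous_L2[OF u_cont], of "Suc (2 * n)" "Suc (2 * k)"]
      by simp
    also have "\<dots> \<le> T n * T k" by (intro mult_mono T_norm) (auto simp: T_def)
    finally show ?thesis .
  qed
  have norm_pos: "f \<noteq> (\<lambda>x. 0) \<Longrightarrow> continuous_on UNIV f \<Longrightarrow> L2_norm m f > 0" for f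
    using continuous_L2_norm_eq_0[of f] by (auto simp: less_le fun_eq_iff)
  have T_pos: "T n > 0" for n
  proof -
    have T0: "T 0 > 0" using norm_pos[OF nz q] by (simp add: T_def u0)
    have "u 1 0 = of_real (T 0)" using T_eq[of 0] by simp
    then have "u 1 \<noteq> (\<lambda>x. 0)" using T0 by auto
    then have T1: "T 1 > 0" using norm_pos[OF _ u_cont, of 1] by (simp add: T_def)
    have "T n > 0 \<and> T (Suc n) > 0"
    proof (induction n)
      case (Suc n)
      then have "0 < (T (Suc n))\<^sup>2" by simp
      also have "\<dots> \<le> T n * T (Suc (Suc n))" by (rule T_convex)
      finally show ?case using Suc by (simp add: zero_less_mult_iff)
    qed (use T0 T1 in simp)
    then show ?thesis by simp
  qed
  define \<rho> where "\<rho> n = T (Suc n) / T n" for n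
  have "incseq \<rho>"
    unfolding incseq_Suc_iff \<rho>_def using T_pos T_convex
    by (auto simp: field_simps power2_eq_square)
  moreover have "\<rho> n \<le> T 0" for n
    using T_submult[of 0 n] T_pos[of n] by (simp add: \<rho>_def field_simps)
  ultimately obtain r where r: "\<rho> \<longlonglongrightarrow> r" "\<And>n. \<rho> n \<le> r"
    using incseq_convergent[of \<rho> "T 0"] by blast
  have "0 < \<rho> 0" using T_pos by (simp add: \<rho>_def)
  then have "r > 0" using r(2)[of 0] by linarith
  define c where "c n = T n / r ^ Suc n" for n
  have "decseq c"
    unfolding decseq_Suc_iff c_def
  proof
    fix n
    have "T (Suc n) \<le> r * T n" using r(2)[of n] T_pos[of n] by (simp add: \<rho>_def field_simps)
    then show "T (Suc n) / r ^ Suc (Suc n) \<le> T n / r ^ Suc n"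
      using \<open>r > 0\<close> by (simp add: field_simps)
  qed
  \<comment> \<open>Let \<open>k\<close> tend to infinity in \<open>T (n + 1 + k) / T k \<le> T n\<close>; the left-hand side is a product of
    \<open>n + 1\<close> ratios, each of which tends to \<open>r\<close>.\<close>
  have c_ge: "1 \<le> c n" for n
  proof -
    have lim: "(\<lambda>k. T (n + k) / T k) \<longlonglongrightarrow> r ^ n" for n
    proof (induction n)
      case 0
      have "T k / T k = 1" for k using T_pos[of k] by simp
      then show ?case by simp
    next
      case (Suc n)
      have "(\<lambda>k. \<rho> (k + n)) \<longlonglongrightarrow> r" using r(1) by (rule LIMSEQ_ignore_initial_segment)
      from tendsto_mult[OF this Suc]
      have "(\<lambda>k. \<rho> (k + n) * (T (n + k) / T k)) \<longlonglongrightarrow> r ^ Suc n" by simp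
      moreover have "\<rho> (k + n) * (T (n + k) / T k) = T (Suc n + k) / T k" for k
        using T_pos[of "n + k"] by (simp add: \<rho>_def add.commute)
      ultimately show ?case by (simp only:)
    qed
    have "r ^ Suc n \<le> T n"
    proof (rule LIMSEQ_le_const2[OF lim])
      show "\<exists>N. \<forall>k\<ge>N. T (Suc n + k) / T k \<le> T n"
        using T_submult[of n] T_pos by (auto simp: field_simps)
    qed
    then show ?thesis using \<open>r > 0\<close> by (simp add: c_def field_simps)
  qed
  obtain cl where cl: "c \<longlonglongrightarrow> cl"
    using decseq_convergent[OF \<open>decseq c\<close>, of 1] c_ge by blast
  define P where "P n = (\<lambda>x. of_real (1 / r ^ Suc n) * u (Suc (2 * n)) x)" for n
  have P_cont: "continuous_on UNIV (P n)" for n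
    unfolding P_def by (intro continuous_intros u_cont)
  have P_inner: "L2_inner m (P i) (P j) = of_real (c (Suc (i + j)))" for i j
  proof -
    have "L2_inner m (P i) (P j) = of_real (1 / r ^ Suc i) * cnj (of_real (1 / r ^ Suc j)
        * L2_inner m (u (Suc (2 * j))) (u (Suc (2 * i))))"
      unfolding P_def L2_inner_scale_left
      by (subst L2_inner_cnj) (simp only: L2_inner_scale_left)
    also have "L2_inner m (u (Suc (2 * j))) (u (Suc (2 * i))) = of_real (T (Suc (i + j)))"
      by (rule T_inner) simp
    finally show ?thesis by (simp add: c_def power_add flip: of_real_mult)
  qed
  have P_diff: "(L2_norm m (\<lambda>x. P i x - P j x))\<^sup>2 = c (Suc (i + i)) - 2 * c (Suc (i + j)) + c (Suc (j + j))" for i j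
  proof -
    have "(L2_norm m (P i))\<^sup>2 = c (Suc (i + i))" for i
      using P_inner[of i i] unfolding L2_inner_self of_real_eq_iff .
    then show ?thesis
      by (simp add: L2_norm_diff_square continuous_L2 P_cont P_inner)
  qed
  have P_Suc: "P (Suc n) = (\<lambda>x. of_real (1 / r) * conv (u 1) (P n) x)" for n
    unfolding P_def conv_scale_right by (simp add: u_conv)
  \<comment> \<open>One more convolution with \<open>u 1\<close> upgrades the \<open>L\<^sup>2\<close>-Cauchy property to uniform convergence.\<close>
  have "uniformly_Cauchy_on UNIV (\<lambda>n. P (Suc n))"
  proof (rule uniformly_Cauchy_onI')
    fix e :: real assume "e > 0"
    define d where "d = e * r / (L2_norm m (u 1) + 1)"
    have nn: "0 \<le> L2_norm m (u 1)" by simp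
    have "d > 0" unfolding d_def using \<open>e > 0\<close> \<open>r > 0\<close> nn
      by (intro divide_pos_pos mult_pos_pos) linarith+
    then have "d\<^sup>2 / 4 > 0" by simp
    then obtain N where N: "\<And>n. n \<ge> N \<Longrightarrow> \<bar>c n - cl\<bar> < d\<^sup>2 / 4"
      using cl unfolding LIMSEQ_iff by (metis real_norm_def)
    show "\<exists>M. \<forall>x\<in>UNIV. \<forall>i\<ge>M. \<forall>n>i. dist (P (Suc i) x) (P (Suc n) x) < e"
    proof (intro exI ballI allI impI)
      fix x i j assume "i \<ge> N" "i < j"
      have D: "continuous_on UNIV (\<lambda>x. P i x - P j x)" by (intro continuous_intros P_cont)
      have "(L2_norm m (\<lambda>x. P i x - P j x))\<^sup>2 < d\<^sup>2"
      proof -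
        have "\<bar>c (Suc (i + i)) - cl\<bar> < d\<^sup>2 / 4" "\<bar>c (Suc (i + j)) - cl\<bar> < d\<^sup>2 / 4"
            "\<bar>c (Suc (j + j)) - cl\<bar> < d\<^sup>2 / 4"
          using \<open>i \<ge> N\<close> \<open>i < j\<close> by (intro N; linarith)+
        then show ?thesis unfolding P_diff by linarith
      qed
      then have "L2_norm m (\<lambda>x. P i x - P j x) < d"
        using \<open>d > 0\<close> by (intro power2_less_imp_less[of _ d]) simp_all
      then have "L2_norm m (u 1) * L2_norm m (\<lambda>x. P i x - P j x) \<le> L2_norm m (u 1) * d"
        by (intro mult_left_mono) auto
      also have "\<dots> < (L2_norm m (u 1) + 1) * d" using \<open>d > 0\<close> by simp
      also have "\<dots> = e * r" using nn by (simp add: d_def add_nonneg_eq_0_iff)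
      finally have "cmod (conv (u 1) (\<lambda>x. P i x - P j x) x) < e * r"
        using conv_bound[OF u_cont D, of 1 x] by simp
      moreover have diff: "P (Suc i) x - P (Suc j) x = of_real (1 / r) * conv (u 1) (\<lambda>x. P i x - P j x) x"
        by (simp add: P_Suc conv_diff_right u_cont P_cont diff_divide_distrib)
      moreover have "dist (P (Suc i) x) (P (Suc j) x) = cmod (conv (u 1) (\<lambda>x. P i x - P j x) x) / r"
        unfolding dist_norm diff using \<open>r > 0\<close> by (simp add: norm_divide)
      ultimately show "dist (P (Suc i) x) (P (Suc j) x) < e"
        using \<open>r > 0\<close> by (simp add: pos_divide_less_eq)
    qed
  qed
  then obtain p where p_lim': "uniform_limit UNIV (\<lambda>n. P (Suc n)) p sequentially"
    using Cauchy_uniformly_convergent uniformly_convergent_on_def by blast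
  have p_lim: "uniform_limit UNIV P p sequentially"
    using p_lim' unfolding uniform_limit_sequentially_iff
    by (metis Suc_le_D Suc_le_mono)
  have p_pt: "(\<lambda>n. P n x) \<longlonglongrightarrow> p x" for x
    using tendsto_uniform_limitI[OF p_lim] by simp
  have p_cont: "continuous_on UNIV p"
    by (rule uniform_limit_theorem[OF _ p_lim]) (auto simp: P_cont)
  have "star p = p"
  proof
    fix x
    have "(\<lambda>n. star (P n) x) \<longlonglongrightarrow> star p x"
      unfolding star_def by (intro tendsto_intros p_pt)
    moreover have "star (P n) x = P n x" for n
      using fun_cong[OF u_star[of "Suc (2 * n)"], of x] by (simp add: P_def star_def)
    ultimately show "star p x = p x" using p_pt[of x] LIMSEQ_unique by simp
  qed
  have kp: "conv (u 1) p = (\<lambda>x. of_real r * p x)"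
  proof
    fix x
    have "(\<lambda>n. conv (u 1) (P n) x) \<longlonglongrightarrow> conv (u 1) p x"
      by (rule conv_uniform_limit[OF u_cont P_cont p_lim])
    moreover have "conv (u 1) (P n) x = of_real r * P (Suc n) x" for n
      using \<open>r > 0\<close> by (simp add: P_Suc)
    moreover have "(\<lambda>n. of_real r * P (Suc n) x) \<longlonglongrightarrow> of_real r * p x"
      by (intro tendsto_intros LIMSEQ_Suc p_pt)
    ultimately show "conv (u 1) p x = of_real r * p x" using LIMSEQ_unique by simp
  qed
  have Pp: "conv (P n) p = p" for n
  proof (induction n)
    case 0
    have "P 0 = (\<lambda>x. of_real (1 / r) * u 1 x)" by (simp add: P_def)
    then show ?case using \<open>r > 0\<close> by (simp only: conv_scale_left kp) simp
  next
    case (Suc n)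
    have "conv (conv (u 1) (P n)) p = (\<lambda>x. of_real r * p x)"
      using Suc kp by (simp add: conv_assoc u_cont P_cont p_cont continuous_integrable)
    then show ?case using \<open>r > 0\<close> by (simp only: P_Suc conv_scale_left) simp
  qed
  have pp: "conv p p = p"
  proof
    fix x
    have "(\<lambda>n. conv p (P n) x) \<longlonglongrightarrow> conv p p x"
      by (rule conv_uniform_limit[OF p_cont P_cont p_lim])
    then show "conv p p x = p x"
      using Pp by (simp add: conv_commute[OF p_cont P_cont] LIMSEQ_const_iff)
  qed
  have "p 0 \<noteq> 0"
  proof
    assume "p 0 = 0"
    then have "(\<lambda>n. cmod (P n 0)) \<longlonglongrightarrow> 0" using tendsto_norm[OF p_pt[of 0]] by simp
    moreover have "cmod (P n 0) = c n" for n
      using T_pos[of n] \<open>r > 0\<close> by (simp add: P_def T_eq c_def norm_mult norm_divide norm_power)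
    ultimately have "1 \<le> (0::real)" using c_ge by (intro LIMSEQ_le_const) auto
    then show False by simp
  qed
  then have "hermitian_idempotent p"
    using p_cont \<open>star p = p\<close> pp by (auto simp: hermitian_idempotent_def)
  moreover have "conv e p = p" if e: "continuous_on UNIV e" and eq: "conv e q = q" for e
  proof
    fix x
    have "conv e (u n) = u n" for n
    proof (cases n)
      case (Suc k)
      then show ?thesis
        using eq e q u_cont[of k] conv_assoc[OF e q continuous_integrable, of "u k"] by (simp add: uSuc)
    qed (simp add: u0 eq)
    then have "conv e (P n) = P n" for n unfolding P_def conv_scale_right by simp
    then show "conv e p x = p x"
      using conv_uniform_limit[OF e P_cont p_lim, of x] p_pt[of x] LIMSEQ_unique by simp
  qed
  moreover have "u 1 = conv q q" using uSuc[of 0] by (simp add: u0)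
  ultimately show ?thesis using that[of r p] \<open>r > 0\<close> kp by simp
qed

end

section \<open>Characters\<close>

lemma dual_group_continuous: "\<phi> \<in> dual_group \<Longrightarrow> continuous_on UNIV \<phi>"
  and dual_group_add: "\<phi> \<in> dual_group \<Longrightarrow> \<phi> (x + y) = \<phi> x * \<phi> y"
  and dual_group_norm: "\<phi> \<in> dual_group \<Longrightarrow> cmod (\<phi> x) = 1"
  by (auto simp: dual_group_def)

lemma dual_group_0: "\<phi> \<in> dual_group \<Longrightarrow> \<phi> 0 = 1"
  using dual_group_add[of \<phi> 0 0] dual_group_norm[of \<phi> 0] by auto

lemma dual_group_uminus:
  assumes "\<phi> \<in> dual_group" shows "\<phi> (- x) = cnj (\<phi> x)"
proof -
  have "\<phi> x * \<phi> (- x) = 1" using dual_group_add[OF assms, of x "- x"] dual_group_0[OF assms] by simp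
  moreover have "\<phi> x * cnj (\<phi> x) = 1"
    using complex_norm_square[of "\<phi> x"] dual_group_norm[OF assms] by simp
  moreover have "\<phi> x \<noteq> 0" using dual_group_norm[OF assms, of x] by auto
  ultimately show ?thesis by (metis mult_left_cancel)
qed

context compact_haar_group
begin

text \<open>
  If \<open>p'\<close> lies strictly below \<open>p\<close>, then \<open>p - p'\<close> is a hermitian idempotent as well, so \<open>p' 0\<close> is
  smaller than \<open>p 0\<close> by at least \<open>1\<close>. Therefore an idempotent whose value at \<open>0\<close> has the least
  integer part is minimal.
\<close>

lemma minimal_idempotent_below:
  assumes "hermitian_idempotent p0"
  obtains p where "hermitian_idempotent p" "conv p0 p = p"
    "\<And>p'. hermitian_idempotent p' \<Longrightarrow> conv p p' = p' \<Longrightarrow> p' = p"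
proof -
  let ?Q = "\<lambda>p. hermitian_idempotent p \<and> conv p0 p = p"
  have "?Q p0" using assms by (simp add: hermitian_idempotent_def)
  then obtain p where p: "?Q p" and least: "\<And>p'. ?Q p' \<Longrightarrow> nat \<lfloor>Re (p 0)\<rfloor> \<le> nat \<lfloor>Re (p' 0)\<rfloor>"
    using ex_has_least_nat[of ?Q p0 "\<lambda>p. nat \<lfloor>Re (p 0)\<rfloor>"] by blast
  have c0: "continuous_on UNIV p0" and cp: "continuous_on UNIV p" "star p = p" "conv p p = p"
    using p assms by (auto simp: hermitian_idempotent_def)
  have "p' = p" if p': "hermitian_idempotent p'" "conv p p' = p'" for p'
  proof (rule ccontr)
    assume "p' \<noteq> p"
    have cp': "continuous_on UNIV p'" "star p' = p'" "conv p' p' = p'"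
      using p' by (auto simp: hermitian_idempotent_def)
    define d where "d = (\<lambda>x. p x - p' x)"
    have cd: "continuous_on UNIV d" unfolding d_def by (intro continuous_intros cp cp')
    have "conv d p = d" "conv d p' = (\<lambda>x. 0)"
      unfolding conv_commute[OF cd cp(1)] conv_commute[OF cd cp'(1)]
      using p'(2) cp cp' conv_commute[OF cp(1) cp'(1)] by (simp_all add: d_def conv_diff_right)
    then have "conv d d = d"
      using conv_diff_right[OF cd cp(1) cp'(1)] by (simp add: d_def)
    moreover have "star d = d"
    proof
      fix x show "star d x = d x"
        using fun_cong[OF cp(2), of x] fun_cong[OF cp'(2), of x] by (simp add: star_def d_def)
    qed
    moreover have dnz: "d \<noteq> (\<lambda>x. 0)"
    proof
      assume d0: "d = (\<lambda>x. 0)"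
      have "p x = p' x" for x using fun_cong[OF d0, of x] unfolding d_def by simp
      then show False using \<open>p' \<noteq> p\<close> by auto
    qed
    ultimately have "hermitian_idempotent d"
      using cd dnz by (simp add: hermitian_idempotent_def)
    then have "Re (p' 0) + 1 \<le> Re (p 0)" using hermitian_idempotent_0(2)[of d] by (simp add: d_def)
    moreover have "1 \<le> Re (p' 0)" using hermitian_idempotent_0(2) p'(1) by simp
    ultimately have less: "nat \<lfloor>Re (p' 0)\<rfloor> < nat \<lfloor>Re (p 0)\<rfloor>" by linarith
    have "conv p0 p' = p'"
      using conv_assoc[OF c0 cp(1) continuous_integrable[OF cp'(1)]] p p'(2) by simp
    then have "nat \<lfloor>Re (p 0)\<rfloor> \<le> nat \<lfloor>Re (p' 0)\<rfloor>" by (intro least conjI p'(1))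
    then show False using less by (rule leD[THEN notE])
  qed
  then show ?thesis using that p by blast
qed

text \<open>
  For hermitian \<open>q\<close> in the range of \<open>p\<close>, the idempotent that \<open>spectral_idempotent\<close> extracts from
  \<open>q\<close> lies below \<open>p\<close>, so it equals \<open>p\<close>, and the convolution square of \<open>q\<close> is a multiple of \<open>p\<close>.
  Applied to both \<open>q\<close> and \<open>q + p\<close>, this shows that \<open>q\<close> itself is a multiple of \<open>p\<close>. A general
  \<open>g\<close> is a combination of two hermitian elements.
\<close>

lemma minimal_idempotent_range:
  assumes p: "hermitian_idempotent p"
    and minimal: "\<And>p'. hermitian_idempotent p' \<Longrightarrow> conv p p' = p' \<Longrightarrow> p' = p"
    and g: "continuous_on UNIV g" "conv p g = g"
  obtains c where "g = (\<lambda>x. c * p x)"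
proof -
  have cp: "continuous_on UNIV p" "star p = p" "conv p p = p"
    using p by (auto simp: hermitian_idempotent_def)
  have square: "\<exists>r. conv q q = (\<lambda>x. r * p x)"
    if q: "continuous_on UNIV q" "star q = q" "conv p q = q" for q
  proof (cases "q = (\<lambda>x. 0)")
    case True
    then have "conv q q = (\<lambda>x. 0 * p x)" by (simp add: conv_def fun_eq_iff)
    then show ?thesis by blast
  next
    case False
    obtain r p' where "r > 0" "hermitian_idempotent p'" "conv (conv q q) p' = (\<lambda>x. of_real r * p' x)"
        "\<And>e. continuous_on UNIV e \<Longrightarrow> conv e q = q \<Longrightarrow> conv e p' = p'"
      using spectral_idempotent[OF q(1,2) False] by blast
    then have "conv (conv q q) p = (\<lambda>x. of_real r * p x)"
      using minimal[of p'] cp(1) q(3) by simp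
    moreover have "conv (conv q q) p = conv q q"
      using conv_commute[OF continuous_conv'[OF q(1,1)] cp(1)]
        conv_assoc[OF cp(1) q(1) continuous_integrable[OF q(1)]] q(3) by simp
    ultimately show ?thesis by auto
  qed
  have herm: "\<exists>c. q = (\<lambda>x. c * p x)"
    if q: "continuous_on UNIV q" "star q = q" "conv p q = q" for q
  proof -
    let ?s = "\<lambda>x. q x + p x"
    have s: "continuous_on UNIV ?s" by (intro continuous_intros q cp)
    have "star ?s = ?s"
      using q(2) cp(2) by (simp add: star_def fun_eq_iff)
    moreover have "conv p ?s = ?s" using q cp by (simp add: conv_add_right)
    ultimately obtain r' where r': "conv ?s ?s = (\<lambda>x. r' * p x)" using square s by blast
    obtain r where r: "conv q q = (\<lambda>x. r * p x)" using square q by blast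
    have sp: "conv ?s p = ?s" using conv_commute[OF s cp(1)] \<open>conv p ?s = ?s\<close> by simp
    have "conv ?s q = (\<lambda>x. conv q q x + q x)"
      using conv_commute[OF s q(1)] conv_add_right[OF q(1) q(1) cp(1)] conv_commute[OF q(1) cp(1)] q(3)
      by simp
    then have "conv ?s ?s = (\<lambda>x. r * p x + q x + (q x + p x))"
      using conv_add_right[OF s q(1) cp(1)] sp r by simp
    then have "q x = (r' - r - 1) / 2 * p x" for x
      using fun_cong[OF r', of x] by (simp add: field_simps)
    then show ?thesis by blast
  qed
  have sg: "continuous_on UNIV (star g)" by (rule continuous_star[OF g(1)])
  have "conv p (star g) = star (conv p g)" using star_conv[OF cp(1) g(1)] cp(2) by simp
  then have psg: "conv p (star g) = star g" using g(2) by simp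
  have "\<exists>c. (\<lambda>x. g x + star g x) = (\<lambda>x. c * p x)"
  proof (rule herm)
    show "continuous_on UNIV (\<lambda>x. g x + star g x)" by (intro continuous_intros g sg)
    show "star (\<lambda>x. g x + star g x) = (\<lambda>x. g x + star g x)" by (simp add: star_def fun_eq_iff)
    show "conv p (\<lambda>x. g x + star g x) = (\<lambda>x. g x + star g x)"
      using conv_add_right[OF cp(1) g(1) sg] psg g(2) by simp
  qed
  moreover have "\<exists>c. (\<lambda>x. \<i> * (g x - star g x)) = (\<lambda>x. c * p x)"
  proof (rule herm)
    show "continuous_on UNIV (\<lambda>x. \<i> * (g x - star g x))" by (intro continuous_intros g sg)
    show "star (\<lambda>x. \<i> * (g x - star g x)) = (\<lambda>x. \<i> * (g x - star g x))"
      by (simp add: star_def fun_eq_iff algebra_simps)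
    show "conv p (\<lambda>x. \<i> * (g x - star g x)) = (\<lambda>x. \<i> * (g x - star g x))"
      using conv_diff_right[OF cp(1) g(1) sg] psg g(2) by (simp add: conv_scale_right)
  qed
  ultimately obtain c1 c2 where c: "\<And>x. g x + star g x = c1 * p x" "\<And>x. \<i> * (g x - star g x) = c2 * p x"
    unfolding fun_eq_iff by blast
  have "g x = (c1 - \<i> * c2) / 2 * p x" for x
  proof -
    have "2 * g x = (g x + star g x) - \<i> * (\<i> * (g x - star g x))"
      by (simp add: algebra_simps flip: mult.assoc)
    also have "\<dots> = (c1 - \<i> * c2) * p x" unfolding c by (simp add: algebra_simps)
    finally show ?thesis by (simp add: mult.commute)
  qed
  then show ?thesis using that by blast
qed

text \<open>
  The translate of \<open>p\<close> by \<open>x\<close> is a multiple of \<open>p\<close>; comparing the values at \<open>0\<close> identifies the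
  factor and gives multiplicativity of \<open>p / p 0\<close>. Its values are bounded by \<open>1\<close>, and so are
  their inverses.
\<close>

lemma minimal_idempotent_character:
  assumes p: "hermitian_idempotent p"
    and minimal: "\<And>p'. hermitian_idempotent p' \<Longrightarrow> conv p p' = p' \<Longrightarrow> p' = p"
  obtains \<phi> where "\<phi> \<in> dual_group" "p = (\<lambda>x. p 0 * \<phi> x)"
proof -
  have cp: "continuous_on UNIV p" "star p = p" "conv p p = p"
    using p by (auto simp: hermitian_idempotent_def)
  have p0: "1 \<le> Re (p 0)" "p 0 = of_real (Re (p 0))"
    using hermitian_idempotent_0(1,2)[OF p] by auto
  then have nz: "p 0 \<noteq> 0" by auto
  define \<phi> where "\<phi> x = p x / p 0" for x
  have mult: "\<phi> (y + x) = \<phi> y * \<phi> x" for x y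
  proof -
    let ?h = "\<lambda>y. p (y - (- x))"
    have h: "continuous_on UNIV ?h" by (intro continuous_translate cp)
    have "conv ?h p = (\<lambda>z. conv p p (z - (- x)))"
      by (simp add: conv_def fun_eq_iff algebra_simps)
    then have "conv p ?h = ?h" using cp conv_commute[OF h cp(1)] by simp
    then obtain c where c: "?h = (\<lambda>x. c * p x)"
      using minimal_idempotent_range[OF p minimal h] by blast
    from fun_cong[OF c, of 0] fun_cong[OF c, of y] show ?thesis using nz
      by (simp add: \<phi>_def field_simps)
  qed
  have le: "cmod (\<phi> x) \<le> 1" for x
  proof -
    have "cmod (p 0) = Re (p 0)" using p0 by (metis abs_of_nonneg le_cases norm_of_real order_trans zero_le_one)
    then show ?thesis using hermitian_idempotent_0(3)[OF p, of x] p0(1)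
      by (simp add: \<phi>_def norm_divide)
  qed
  have "cmod (\<phi> x) = 1" for x
  proof -
    have "\<phi> x * \<phi> (- x) = 1" using mult[of x "- x"] nz by (simp add: \<phi>_def)
    then have "cmod (\<phi> x) * cmod (\<phi> (- x)) = 1" by (metis norm_mult norm_one)
    then have "1 \<le> cmod (\<phi> x)" using le[of "- x"] mult_left_mono[OF le[of "- x"], of "cmod (\<phi> x)"] by simp
    then show ?thesis using le[of x] by simp
  qed
  moreover have "continuous_on UNIV \<phi>" unfolding \<phi>_def using nz by (intro continuous_intros cp) auto
  ultimately have "\<phi> \<in> dual_group" by (simp add: dual_group_def mult)
  moreover have "p = (\<lambda>x. p 0 * \<phi> x)" using nz by (simp add: \<phi>_def)
  ultimately show ?thesis using that by blast
qed

text \<open>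
  Characters are the eigenvectors of all convolution operators, with the Fourier coefficients as
  eigenvalues.
\<close>

lemma conv_character:
  assumes \<phi>: "\<phi> \<in> dual_group"
  shows "conv \<phi> f x = \<phi> x * fourier m f \<phi>"
proof -
  have "\<phi> (x - y) = \<phi> x * cnj (\<phi> y)" for y
    using dual_group_add[OF \<phi>, of x "- y"] dual_group_uminus[OF \<phi>] by simp
  then show ?thesis by (simp add: conv_def fourier_def mult_ac)
qed

text \<open>
  Below the top spectral idempotent of \<open>q = star g * g\<close> (convolution) there is a minimal one, a
  multiple of a character \<open>\<phi>\<close>. Convolution by the square of \<open>q\<close> acts on \<open>\<phi>\<close> as the positive
  number \<open>r\<close>; if \<open>fourier m g \<phi>\<close> vanished it would annihilate \<open>\<phi>\<close>.
\<close>

lemma fourier_nonzero: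
  assumes g: "continuous_on UNIV g" and nz: "g \<noteq> (\<lambda>x. 0)"
  obtains \<phi> where "\<phi> \<in> dual_group" "fourier m g \<phi> \<noteq> 0"
proof -
  have sg: "continuous_on UNIV (star g)" by (rule continuous_star[OF g])
  define q where "q = conv (star g) g"
  have q: "continuous_on UNIV q" unfolding q_def by (intro continuous_conv' g sg)
  have qs: "star q = q" unfolding q_def star_conv[OF sg g] using conv_commute[OF sg g] by simp
  have "q 0 \<noteq> 0"
    using conv_star_0[OF g] continuous_L2_norm_eq_0[OF g] nz conv_commute[OF sg g]
    by (auto simp: q_def)
  then have "q \<noteq> (\<lambda>x. 0)" by auto
  then obtain r p0 where r: "r > 0" "hermitian_idempotent p0" "conv (conv q q) p0 = (\<lambda>x. of_real r * p0 x)"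
    using spectral_idempotent[OF q qs] by blast
  obtain p where p: "hermitian_idempotent p" "conv p0 p = p"
      and minimal: "\<And>p'. hermitian_idempotent p' \<Longrightarrow> conv p p' = p' \<Longrightarrow> p' = p"
    using minimal_idempotent_below[OF r(2)] by blast
  have cp: "continuous_on UNIV p" "continuous_on UNIV p0"
    using p(1) r(2) by (auto simp: hermitian_idempotent_def)
  have qq: "continuous_on UNIV (conv q q)" by (intro continuous_conv' q)
  have "conv (conv q q) (conv p0 p) = conv (\<lambda>x. of_real r * p0 x) p"
    using conv_assoc[OF qq cp(2) continuous_integrable[OF cp(1)]] r(3) by simp
  then have qqp: "conv (conv q q) p = (\<lambda>x. of_real r * p x)"
    by (simp add: p(2) conv_scale_left)
  obtain \<phi> where \<phi>: "\<phi> \<in> dual_group" "p = (\<lambda>x. p 0 * \<phi> x)"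
    using minimal_idempotent_character[OF p(1) minimal] by blast
  have c\<phi>: "continuous_on UNIV \<phi>" using \<phi>(1) by (rule dual_group_continuous)
  have "fourier m g \<phi> \<noteq> 0"
  proof
    assume "fourier m g \<phi> = 0"
    then have "conv g \<phi> = (\<lambda>x. 0)"
      using conv_commute[OF g c\<phi>] conv_character[OF \<phi>(1), of g] by (simp add: fun_eq_iff)
    then have "conv g p = (\<lambda>x. 0)"
      by (subst \<phi>(2)) (simp add: conv_scale_right)
    then have "conv q p = conv (star g) (\<lambda>x. 0)"
      using conv_assoc[OF sg g continuous_integrable[OF cp(1)]] by (simp add: q_def)
    also have "\<dots> = (\<lambda>x. 0)" by (simp add: conv_def fun_eq_iff)
    finally have "conv (conv q q) p = conv q (\<lambda>x. 0)"
      using conv_assoc[OF q q continuous_integrable[OF cp(1)]] by simp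
    also have "\<dots> = (\<lambda>x. 0)" by (simp add: conv_def fun_eq_iff)
    finally have "(\<lambda>x. of_real r * p x) = (\<lambda>x. 0)" using qqp by simp
    then have "of_real r * p 0 = 0" by (rule fun_cong)
    then show False using r(1) hermitian_idempotent_0(2)[OF p(1)] by auto
  qed
  then show ?thesis using that \<phi>(1) by blast
qed

section \<open>Completeness of the characters\<close>

lemma haar_approximation:
  assumes B: "B \<in> sets borel" and "\<epsilon> > 0"
  obtains K U where "compact K" "open U" "K \<subseteq> B" "B \<subseteq> U" "measure m (U - K) < \<epsilon>"
proof -
  have reg: "emeasure m B = (SUP K\<in>{K. K \<subseteq> B \<and> compact K}. emeasure m K)"
    "emeasure m B = (INF U\<in>{U. B \<subseteq> U \<and> open U}. emeasure m U)"
    using haar B unfolding normalized_haar_def by blast+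
  obtain U where U: "B \<subseteq> U" "open U" "measure m U < measure m B + \<epsilon> / 2"
  proof -
    have "(INF U\<in>{U. B \<subseteq> U \<and> open U}. emeasure m U) < ennreal (measure m B + \<epsilon> / 2)"
    proof -
      have "emeasure m B < ennreal (measure m B + \<epsilon> / 2)"
        unfolding emeasure_eq_measure using \<open>\<epsilon> > 0\<close> by (simp add: ennreal_less_iff del: ennreal_plus)
      then show ?thesis by (simp only: reg(2)[symmetric])
    qed
    then obtain U where "B \<subseteq> U" "open U" "emeasure m U < ennreal (measure m B + \<epsilon> / 2)"
      unfolding INF_less_iff by blast
    then show ?thesis using that by (simp add: emeasure_eq_measure ennreal_less_iff)
  qed
  obtain K where K: "K \<subseteq> B" "compact K" "measure m B - \<epsilon> / 2 < measure m K"
  proof (cases "measure m B - \<epsilon> / 2 < 0")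
    case True
    show ?thesis by (rule that[of "{}"]) (use True in auto)
  next
    case False
    have "ennreal (measure m B - \<epsilon> / 2) < (SUP K\<in>{K. K \<subseteq> B \<and> compact K}. emeasure m K)"
    proof -
      have "ennreal (measure m B - \<epsilon> / 2) < emeasure m B"
        unfolding emeasure_eq_measure using \<open>\<epsilon> > 0\<close> False by (simp add: ennreal_less_iff)
      then show ?thesis by (simp only: reg(1)[symmetric])
    qed
    then obtain K where "K \<subseteq> B" "compact K" "ennreal (measure m B - \<epsilon> / 2) < emeasure m K"
      unfolding less_SUP_iff by blast
    then show ?thesis using that False by (simp add: emeasure_eq_measure ennreal_less_iff)
  qed
  have "measure m (U - K) = measure m U - measure m K"
    using U K by (intro finite_measure_Diff) (auto intro: borel_compact)
  then show ?thesis using that U K by simp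
qed

lemma Urysohn_function:
  assumes "compact K" "open U" "K \<subseteq> (U :: 'g set)"
  obtains h :: "'g \<Rightarrow> real" where "continuous_on UNIV h" "\<And>x. h x \<in> {0..1}"
    "\<And>x. x \<in> K \<Longrightarrow> h x = 1" "\<And>x. x \<notin> U \<Longrightarrow> h x = 0"
proof -
  have "Hausdorff_space (euclidean :: 'g topology)"
    by (simp add: Hausdorff_space_def disjnt_def) (metis hausdorff)
  then have "normal_space (euclidean :: 'g topology)"
    using compact_UNIV by (intro compact_Hausdorff_or_regular_imp_normal_space) (auto simp: compact_space_def)
  moreover have "closedin euclidean (- U)" "closedin euclidean K" "disjnt (- U) K"
    using assms by (auto simp: disjnt_def compact_imp_closed)
  ultimately obtain h :: "'g \<Rightarrow> real" where h: "continuous_map euclidean (top_of_set {0..1}) h"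
      "h ` (- U) \<subseteq> {0}" "h ` K \<subseteq> {1}"
    using Urysohn_lemma[of euclidean "- U" K 0 1] by auto
  show ?thesis
    by (rule that[of h]) (use h in \<open>auto simp: continuous_map_in_subtopology\<close>)
qed

text \<open>
  For a Borel set \<open>B\<close> choose \<open>K \<subseteq> B \<subseteq> U\<close> by regularity and a Urysohn function \<open>h\<close> between \<open>K\<close>
  and \<open>U\<close>. It differs from the indicator of \<open>B\<close> only on \<open>U - K\<close>, by at most \<open>1\<close>, so the integral
  of \<open>f\<close> over \<open>B\<close> is as small as one likes.
\<close>

lemma continuous_functions_separate:
  assumes f: "f \<in> L2 m" and zero: "\<And>h. continuous_on UNIV h \<Longrightarrow> (LINT x|m. f x * cnj (h x)) = 0"
  shows "AE x in m. f x = 0"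
proof (rule density_zero)
  have [measurable]: "f \<in> borel_measurable m" using f by (rule L2_measurable)
  have one: "(\<lambda>x. 1) \<in> L2 m" by (simp add: L2_def)
  show int: "integrable m f" using L2_inner_integrable[OF f one] by simp
  fix B assume "B \<in> sets m"
  then have B [measurable]: "B \<in> sets m" and B': "B \<in> sets borel" by auto
  have small: "cmod (set_lebesgue_integral m B f) \<le> L2_norm m f * sqrt \<epsilon>" if pos: "\<epsilon> > 0" for \<epsilon>
  proof -
    obtain K U where KU: "compact K" "open U" "K \<subseteq> B" "B \<subseteq> U" "measure m (U - K) < \<epsilon>"
      using haar_approximation[OF B' pos] by blast
    obtain h :: "'g \<Rightarrow> real" where h: "continuous_on UNIV h" "\<And>x. h x \<in> {0..1}"
        "\<And>x. x \<in> K \<Longrightarrow> h x = 1" "\<And>x. x \<notin> U \<Longrightarrow> h x = 0"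
      using Urysohn_function[of K U] KU by blast
    have meas: "U - K \<in> sets m" using KU by (auto intro: borel_compact)
    have [measurable]: "h \<in> borel_measurable m" using continuous_measurable h(1) by auto
    let ?i = "\<lambda>x. of_real (indicator B x) :: complex" and ?h = "\<lambda>x. of_real (h x) :: complex"
    have i: "?i \<in> L2 m"
      unfolding L2_def by (auto intro!: integrable_const_bound[of _ 1] simp: indicator_def)
    have ch: "continuous_on UNIV ?h" by (intro continuous_intros h)
    have le: "(cmod (?i x - ?h x))\<^sup>2 \<le> indicator (U - K) x" for x
    proof (cases "x \<in> U - K")
      case True
      have "cmod (?i x - ?h x) = \<bar>indicator B x - h x\<bar>"
        unfolding of_real_diff[symmetric] norm_of_real ..
      also have "\<dots> \<le> 1" using h(2)[of x] by (auto simp: indicator_def abs_le_iff)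
      finally show ?thesis using True by (simp add: power_le_one)
    next
      case False
      then show ?thesis using h(3,4)[of x] KU by (auto simp: indicator_def)
    qed
    have "(L2_norm m (\<lambda>x. ?i x - ?h x))\<^sup>2 \<le> (LINT x|m. indicator (U - K) x)"
      unfolding L2_norm_square
      using le meas L2_integrable_square[OF L2_diff[OF i continuous_L2[OF ch]]]
      by (intro integral_mono integrable_real_indicator) (auto simp: emeasure_eq_measure)
    also have "\<dots> \<le> \<epsilon>" using KU(5) meas by simp
    finally have norm_le: "L2_norm m (\<lambda>x. ?i x - ?h x) \<le> sqrt \<epsilon>"
      by (simp add: real_le_rsqrt)
    have "set_lebesgue_integral m B f = (LINT x|m. f x * cnj (?i x))"
      unfolding set_lebesgue_integral_def by (intro Bochner_Integration.integral_cong) (auto simp: indicator_def)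
    also have "\<dots> = (LINT x|m. f x * cnj (?i x)) - (LINT x|m. f x * cnj (?h x))"
      using zero[OF ch] by simp
    also have "\<dots> = L2_inner m f (\<lambda>x. ?i x - ?h x)"
      unfolding L2_inner_def
      using L2_inner_integrable[OF f i] L2_inner_integrable[OF f continuous_L2[OF ch]]
      by (subst Bochner_Integration.integral_diff[symmetric]) (auto simp: ring_distribs)
    also have "cmod \<dots> \<le> L2_norm m f * L2_norm m (\<lambda>x. ?i x - ?h x)"
      by (intro L2_Cauchy_Schwarz f L2_diff i continuous_L2 ch)
    also have "\<dots> \<le> L2_norm m f * sqrt \<epsilon>" by (intro mult_left_mono norm_le) simp
    finally show ?thesis .
  qed
  have "((\<lambda>\<epsilon>. L2_norm m f * sqrt \<epsilon>) \<longlongrightarrow> L2_norm m f * sqrt 0) (at_right 0)"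
    by (intro tendsto_intros)
  then have "cmod (set_lebesgue_integral m B f) \<le> L2_norm m f * sqrt 0"
    by (rule tendsto_lowerbound) (auto simp: eventually_at_right_field intro!: exI[of _ 1] small)
  then show "set_lebesgue_integral m B f = 0" by simp
qed

text \<open>
  For continuous \<open>g\<close> the function \<open>conv g f\<close> is continuous, and its Fourier coefficients are
  products of those of \<open>g\<close> and \<open>f\<close>, hence zero. So \<open>conv g f\<close> vanishes identically; its value at
  \<open>0\<close> is the integral of \<open>f\<close> against the reflection of \<open>g\<close>, an arbitrary continuous function.
\<close>

theorem fourier_eq_0_imp_AE_0:
  assumes f: "f \<in> L2 m" and zero: "\<And>\<phi>. \<phi> \<in> dual_group \<Longrightarrow> fourier m f \<phi> = 0"
  shows "AE x in m. f x = 0"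
proof (rule continuous_functions_separate[OF f])
  fix h :: "'g \<Rightarrow> complex" assume h: "continuous_on UNIV h"
  have one: "(\<lambda>x. 1) \<in> L2 m" by (simp add: L2_def)
  have int: "integrable m f" using L2_inner_integrable[OF f one] by simp
  define g where "g = (\<lambda>x. cnj (h (- x)))"
  have g: "continuous_on UNIV g" unfolding g_def by (intro continuous_intros continuous_translate h)
  have "fourier m (conv g f) \<phi> = 0" if \<phi>: "\<phi> \<in> dual_group" for \<phi>
  proof -
    have c\<phi>: "continuous_on UNIV \<phi>" using \<phi> by (rule dual_group_continuous)
    have c\<phi>': "continuous_on UNIV (\<lambda>x. cnj (\<phi> x))" by (intro continuous_intros c\<phi>)
    have "fourier m (conv g f) \<phi> = (LINT x|m. cnj (\<phi> x) * (LINT y|m. g (x - y) * f y))"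
      by (simp add: fourier_def conv_def mult.commute)
    also have "\<dots> = (LINT y|m. (LINT x|m. cnj (\<phi> x) * g (x - y)) * f y)"
      by (intro Fubini_kernel g int continuous_integrable c\<phi>')
    also have "(\<lambda>y. LINT x|m. cnj (\<phi> x) * g (x - y)) = (\<lambda>y. cnj (\<phi> y) * fourier m g \<phi>)"
    proof
      fix y
      have "(LINT x|m. cnj (\<phi> x) * g (x - y)) = (LINT x|m. cnj (\<phi> (y + x)) * g ((y + x) - y))"
        by (intro integral_translate[symmetric] continuous_measurable continuous_intros continuous_translate c\<phi> g)
      then show "(LINT x|m. cnj (\<phi> x) * g (x - y)) = cnj (\<phi> y) * fourier m g \<phi>"
        by (simp add: fourier_def dual_group_add[OF \<phi>] mult_ac flip: integral_mult_right_zero)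
    qed
    also have "(LINT y|m. cnj (\<phi> y) * fourier m g \<phi> * f y) = fourier m g \<phi> * fourier m f \<phi>"
    proof -
      have "(LINT y|m. cnj (\<phi> y) * c * f y) = c * fourier m f \<phi>" for c
        unfolding fourier_def integral_mult_right_zero[symmetric] by (simp add: mult_ac)
      then show ?thesis .
    qed
    finally show ?thesis using zero[OF \<phi>] by simp
  qed
  then have "conv g f = (\<lambda>x. 0)"
    using fourier_nonzero[OF continuous_conv[OF g int]] by blast
  from fun_cong[OF this, of 0] show "(LINT x|m. f x * cnj (h x)) = 0"
    by (simp add: conv_def g_def mult.commute)
qed

end

section \<open>The theorems of Riesz-Fischer and Parseval\<close>

context prob_space
begin

text \<open>
  Completeness of \<open>L\<^sup>2\<close>, for a sequence that converges geometrically: the increments are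
  summable in \<open>L\<^sup>1\<close>, so the sequence converges almost everywhere, and Fatou's lemma turns the
  bounds on \<open>\<parallel>g k - g n\<parallel>\<close> into bounds on the distance to the limit.
\<close>

lemma L2_Cauchy_limit:
  assumes g: "\<And>n. g n \<in> L2 M"
    and step: "\<And>n. L2_norm M (\<lambda>x. g (Suc n) x - g n x) \<le> (1 / 2) ^ n"
  obtains h where "h \<in> L2 M" "\<And>n. L2_norm M (\<lambda>x. h x - g n x) \<le> 2 * (1 / 2) ^ n"
proof -
  have [measurable]: "g n \<in> borel_measurable M" for n using g by (rule L2_measurable)
  have one: "(\<lambda>x. 1) \<in> L2 M" by (simp add: L2_def)
  have norm_one: "L2_norm M (\<lambda>x. 1) = 1" by (simp add: L2_norm_def prob_space)
  let ?d = "\<lambda>n x. g (Suc n) x - g n x"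
  have d: "?d n \<in> L2 M" for n by (intro L2_diff g)
  have nn_le: "(\<integral>\<^sup>+x. ennreal (cmod (?d n x)) \<partial>M) \<le> ennreal ((1 / 2) ^ n)" for n
  proof -
    have cn: "(\<lambda>x. of_real (cmod (?d n x))) \<in> L2 M" using d[of n] by (auto simp: L2_def)
    have "integrable M (\<lambda>x. of_real (cmod (?d n x)) * cnj 1 :: complex)"
      by (rule L2_inner_integrable[OF cn one])
    then have int: "integrable M (\<lambda>x. cmod (?d n x))" by (simp add: complex_of_real_integrable_eq)
    have "of_real (LINT x|M. cmod (?d n x)) = L2_inner M (\<lambda>x. of_real (cmod (?d n x))) (\<lambda>x. 1)"
      by (simp add: L2_inner_def)
    then have "\<bar>LINT x|M. cmod (?d n x)\<bar> = cmod (L2_inner M (\<lambda>x. of_real (cmod (?d n x))) (\<lambda>x. 1))"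
      by (metis norm_of_real)
    also have "\<dots> \<le> L2_norm M (\<lambda>x. of_real (cmod (?d n x))) * L2_norm M (\<lambda>x. 1)"
      by (rule L2_Cauchy_Schwarz[OF cn one])
    also have "\<dots> = L2_norm M (?d n)" unfolding norm_one by (simp add: L2_norm_def)
    finally have "\<bar>LINT x|M. cmod (?d n x)\<bar> \<le> L2_norm M (?d n)" .
    then have "(LINT x|M. cmod (?d n x)) \<le> (1 / 2) ^ n" using step[of n] by linarith
    then show ?thesis using int by (simp add: nn_integral_eq_integral ennreal_leI)
  qed
  have "(\<integral>\<^sup>+x. (\<Sum>n. ennreal (cmod (?d n x))) \<partial>M) = (\<Sum>n. \<integral>\<^sup>+x. ennreal (cmod (?d n x)) \<partial>M)"
    by (rule nn_integral_suminf) measurable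
  also have "\<dots> \<le> (\<Sum>n. ennreal ((1 / 2) ^ n))" by (intro suminf_le nn_le) auto
  also have "\<dots> = ennreal (\<Sum>n. (1 / 2) ^ n)" by (intro suminf_ennreal2) (auto intro: summable_geometric)
  also have "\<dots> < \<infinity>" by simp
  finally have "AE x in M. (\<Sum>n. ennreal (cmod (?d n x))) \<noteq> \<infinity>"
    by (intro nn_integral_PInf_AE) auto
  then have conv: "AE x in M. (\<lambda>n. g n x) \<longlonglongrightarrow> lim (\<lambda>n. g n x)"
  proof eventually_elim
    case (elim x)
    then have "summable (\<lambda>n. cmod (?d n x))" by (intro summable_suminf_not_top) auto
    then have "summable (\<lambda>n. ?d n x)" by (rule summable_norm_cancel)
    then have "convergent (\<lambda>n. \<Sum>i<n. ?d i x)" by (simp add: summable_iff_convergent)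
    then have "convergent (\<lambda>n. g n x - g 0 x)"
      by (simp add: sum_lessThan_telescope[of "\<lambda>n. g n x"])
    then have "convergent (\<lambda>n. g n x)"
      using convergent_add_const_right_iff[of "\<lambda>n. g n x" "- g 0 x"] by simp
    then show ?case by (simp add: convergent_LIMSEQ_iff)
  qed
  define h where "h x = lim (\<lambda>n. g n x)" for x
  have [measurable]: "h \<in> borel_measurable M" unfolding h_def by measurable
  \<comment> \<open>Subtracting the geometric tail makes the bound on the partial sums provable by induction.\<close>
  have tail: "L2_norm M (\<lambda>x. g (n + k) x - g n x) \<le> 2 * (1 / 2) ^ n - (1 / 2) ^ (n + k) * 2" for n k
  proof (induction k)
    case 0
    then show ?case by (simp add: L2_norm_def)
  next
    case (Suc k)
    have "L2_norm M (\<lambda>x. g (n + Suc k) x - g n x)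
        = L2_norm M (\<lambda>x. ?d (n + k) x - (-1) * (g (n + k) x - g n x))" by simp
    also have "\<dots> \<le> L2_norm M (?d (n + k)) + L2_norm M (\<lambda>x. (-1) * (g (n + k) x - g n x))"
      by (intro L2_norm_triangle L2_scale L2_diff g)
    also have "\<dots> \<le> (1 / 2) ^ (n + k) + (2 * (1 / 2) ^ n - (1 / 2) ^ (n + k) * 2)"
      using step[of "n + k"] Suc by (subst L2_norm_scale) simp
    finally show ?case by simp
  qed
  have tail': "L2_norm M (\<lambda>x. g k x - g n x) \<le> 2 * (1 / 2) ^ n" if "k \<ge> n" for k n
  proof -
    have "0 \<le> (1 / 2 :: real) ^ k * 2" by simp
    moreover have "L2_norm M (\<lambda>x. g k x - g n x) \<le> 2 * (1 / 2) ^ n - (1 / 2) ^ k * 2"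
      using tail[of n "k - n"] that by simp
    ultimately show ?thesis by linarith
  qed
  have fatou: "(\<integral>\<^sup>+x. ennreal ((cmod (h x - g n x))\<^sup>2) \<partial>M) \<le> ennreal ((2 * (1 / 2) ^ n)\<^sup>2)" for n
  proof -
    have "(\<integral>\<^sup>+x. ennreal ((cmod (h x - g n x))\<^sup>2) \<partial>M)
        = (\<integral>\<^sup>+x. liminf (\<lambda>k. ennreal ((cmod (g k x - g n x))\<^sup>2)) \<partial>M)"
    proof (rule nn_integral_cong_AE)
      show "AE x in M. ennreal ((cmod (h x - g n x))\<^sup>2) = liminf (\<lambda>k. ennreal ((cmod (g k x - g n x))\<^sup>2))"
        using conv
      proof eventually_elim
        case (elim x)
        then have "(\<lambda>k. ennreal ((cmod (g k x - g n x))\<^sup>2)) \<longlonglongrightarrow> ennreal ((cmod (h x - g n x))\<^sup>2)"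
          unfolding h_def by (intro tendsto_intros tendsto_ennrealI)
        from lim_imp_Liminf[OF _ this] show ?case by simp
      qed
    qed
    also have "\<dots> \<le> liminf (\<lambda>k. \<integral>\<^sup>+x. ennreal ((cmod (g k x - g n x))\<^sup>2) \<partial>M)"
      by (rule nn_integral_liminf) measurable
    also have "\<dots> \<le> liminf (\<lambda>k::nat. ennreal ((2 * (1 / 2) ^ n)\<^sup>2))"
    proof (rule Liminf_mono)
      show "\<forall>\<^sub>F k in sequentially. (\<integral>\<^sup>+x. ennreal ((cmod (g k x - g n x))\<^sup>2) \<partial>M) \<le> ennreal ((2 * (1 / 2) ^ n)\<^sup>2)"
        using eventually_ge_at_top[of n]
      proof eventually_elim
        case (elim k)
        have "(\<integral>\<^sup>+x. ennreal ((cmod (g k x - g n x))\<^sup>2) \<partial>M) = ennreal ((L2_norm M (\<lambda>x. g k x - g n x))\<^sup>2)"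
          unfolding L2_norm_square
          by (intro nn_integral_eq_integral L2_integrable_square L2_diff g) auto
        also have "\<dots> \<le> ennreal ((2 * (1 / 2) ^ n)\<^sup>2)"
          using tail'[OF elim] by (intro ennreal_leI power_mono) auto
        finally show ?case .
      qed
    qed
    also have "\<dots> = ennreal ((2 * (1 / 2) ^ n)\<^sup>2)" by (rule Liminf_const) simp
    finally show ?thesis .
  qed
  have diff: "(\<lambda>x. h x - g n x) \<in> L2 M" for n
  proof -
    have "(\<integral>\<^sup>+x. ennreal ((cmod (h x - g n x))\<^sup>2) \<partial>M) < \<infinity>"
      using fatou[of n] by (rule order_le_less_trans) simp
    then have "integrable M (\<lambda>x. (cmod (h x - g n x))\<^sup>2)"
      by (intro integrableI_nonneg) auto
    then show ?thesis by (simp add: L2_def)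
  qed
  have "h \<in> L2 M" using L2_add[OF diff[of 0] g[of 0]] by simp
  moreover have "L2_norm M (\<lambda>x. h x - g n x) \<le> 2 * (1 / 2) ^ n" for n
  proof (rule power2_le_imp_le)
    have "ennreal ((L2_norm M (\<lambda>x. h x - g n x))\<^sup>2) = (\<integral>\<^sup>+x. ennreal ((cmod (h x - g n x))\<^sup>2) \<partial>M)"
      unfolding L2_norm_square
      by (intro nn_integral_eq_integral[symmetric] L2_integrable_square diff) auto
    also have "\<dots> \<le> ennreal ((2 * (1 / 2) ^ n)\<^sup>2)" by (rule fatou)
    finally show "(L2_norm M (\<lambda>x. h x - g n x))\<^sup>2 \<le> (2 * (1 / 2) ^ n)\<^sup>2"
      by (rule ennreal_le_iff[THEN iffD1, rotated]) simp
  qed simp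
  ultimately show ?thesis using that by blast
qed

end

lemma fourier_eq_inner: "fourier m f \<phi> = L2_inner m f \<phi>"
  by (simp add: fourier_def L2_inner_def)

text \<open>
  With \<open>c = fourier m f\<close> this is the partial sum over \<open>T\<close> of the Fourier series of \<open>f\<close>.
\<close>

definition char_sum :: "('g \<Rightarrow> complex) set \<Rightarrow> (('g \<Rightarrow> complex) \<Rightarrow> complex) \<Rightarrow> 'g \<Rightarrow> complex" where
  "char_sum T c = (\<lambda>x. \<Sum>\<phi>\<in>T. c \<phi> * \<phi> x)"

context compact_haar_group
begin

lemma dual_group_L2: "\<phi> \<in> dual_group \<Longrightarrow> \<phi> \<in> L2 m"
  by (intro continuous_L2 dual_group_continuous)

lemma dual_group_L2_norm: "\<phi> \<in> dual_group \<Longrightarrow> L2_norm m \<phi> = 1"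
  using prob_space by (simp add: L2_norm_def dual_group_norm)

text \<open>
  Translating by \<open>y\<close> multiplies the integral of \<open>\<phi> * cnj \<psi>\<close> by \<open>\<phi> y * cnj (\<psi> y)\<close>, which
  differs from \<open>1\<close> as soon as \<open>\<phi> y \<noteq> \<psi> y\<close>.
\<close>

lemma fourier_character:
  assumes \<phi>: "\<phi> \<in> dual_group" and \<psi>: "\<psi> \<in> dual_group"
  shows "fourier m \<phi> \<psi> = (if \<phi> = \<psi> then 1 else 0)"
proof (cases "\<phi> = \<psi>")
  case True
  have "\<psi> x * cnj (\<psi> x) = 1" for x
    using complex_norm_square[of "\<psi> x"] dual_group_norm[OF \<psi>] by simp
  then show ?thesis using True prob_space by (simp add: fourier_def)
next
  case False
  then obtain y where y: "\<phi> y \<noteq> \<psi> y" by auto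
  have "fourier m \<phi> \<psi> = (LINT x|m. \<phi> (y + x) * cnj (\<psi> (y + x)))"
    unfolding fourier_def
    by (intro integral_translate[symmetric] continuous_measurable continuous_intros dual_group_continuous assms)
  also have "\<dots> = \<phi> y * cnj (\<psi> y) * fourier m \<phi> \<psi>"
    unfolding fourier_def integral_mult_right_zero[symmetric]
    by (simp add: dual_group_add \<phi> \<psi> mult_ac)
  finally have eq: "fourier m \<phi> \<psi> = \<phi> y * cnj (\<psi> y) * fourier m \<phi> \<psi>" .
  have "\<phi> y * cnj (\<psi> y) \<noteq> 1"
  proof
    assume "\<phi> y * cnj (\<psi> y) = 1"
    moreover have "\<psi> y * cnj (\<psi> y) = 1"
      using complex_norm_square[of "\<psi> y"] dual_group_norm[OF \<psi>] by simp
    moreover have "cnj (\<psi> y) \<noteq> 0" using dual_group_norm[OF \<psi>, of y] by auto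
    ultimately show False using y by (metis mult_right_cancel)
  qed
  then show ?thesis using eq False by simp
qed

lemma char_sum_L2: "T \<subseteq> dual_group \<Longrightarrow> char_sum T c \<in> L2 m"
  unfolding char_sum_def by (intro L2_sum L2_scale dual_group_L2) auto

lemma inner_char_sum_left:
  assumes "T \<subseteq> dual_group" "h \<in> L2 m"
  shows "L2_inner m (char_sum T c) h = (\<Sum>\<phi>\<in>T. c \<phi> * L2_inner m \<phi> h)"
  unfolding char_sum_def using assms dual_group_L2
  by (subst L2_inner_sum_left) (auto simp: L2_inner_scale_left intro!: L2_scale)

lemma fourier_char_sum:
  assumes "finite T" "T \<subseteq> dual_group" "\<psi> \<in> dual_group"
  shows "fourier m (char_sum T c) \<psi> = (if \<psi> \<in> T then c \<psi> else 0)"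
proof -
  have "fourier m (char_sum T c) \<psi> = (\<Sum>\<phi>\<in>T. c \<phi> * (if \<phi> = \<psi> then 1 else 0))"
    unfolding fourier_eq_inner inner_char_sum_left[OF assms(2) dual_group_L2[OF assms(3)]]
    using assms by (intro sum.cong refl) (auto simp: fourier_character simp flip: fourier_eq_inner)
  also have "\<dots> = (if \<psi> \<in> T then c \<psi> else 0)"
    using assms(1) by (simp add: if_distrib[of "(*) _"] cong: if_cong)
  finally show ?thesis .
qed

lemma inner_char_sum_right:
  assumes "T \<subseteq> dual_group" "f \<in> L2 m"
  shows "L2_inner m f (char_sum T c) = (\<Sum>\<phi>\<in>T. cnj (c \<phi>) * fourier m f \<phi>)"
  using inner_char_sum_left[OF assms, of c]
  by (subst L2_inner_cnj) (simp add: fourier_eq_inner L2_inner_cnj[of m f])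

lemma char_sum_norm:
  assumes T: "finite T" "T \<subseteq> dual_group"
  shows "(L2_norm m (char_sum T c))\<^sup>2 = (\<Sum>\<phi>\<in>T. (cmod (c \<phi>))\<^sup>2)"
proof -
  have "of_real ((L2_norm m (char_sum T c))\<^sup>2) = (\<Sum>\<phi>\<in>T. cnj (c \<phi>) * fourier m (char_sum T c) \<phi>)"
    unfolding L2_inner_self[symmetric] by (rule inner_char_sum_right[OF T(2) char_sum_L2[OF T(2)]])
  also have "\<dots> = (\<Sum>\<phi>\<in>T. of_real ((cmod (c \<phi>))\<^sup>2))"
    using T complex_norm_square by (intro sum.cong refl) (simp add: fourier_char_sum subsetD mult.commute)
  finally show ?thesis by (simp only: of_real_sum[symmetric] of_real_eq_iff)
qed

lemma char_sum_distance:
  assumes T: "finite T" "T \<subseteq> dual_group" and f: "f \<in> L2 m"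
  shows "(L2_norm m (\<lambda>x. f x - char_sum T (fourier m f) x))\<^sup>2
    = (L2_norm m f)\<^sup>2 - (\<Sum>\<phi>\<in>T. (cmod (fourier m f \<phi>))\<^sup>2)"
proof -
  have "L2_inner m f (char_sum T (fourier m f)) = (\<Sum>\<phi>\<in>T. of_real ((cmod (fourier m f \<phi>))\<^sup>2))"
    unfolding inner_char_sum_right[OF T(2) f]
    by (intro sum.cong refl) (simp only: complex_norm_square mult.commute)
  then have "Re (L2_inner m f (char_sum T (fourier m f))) = (\<Sum>\<phi>\<in>T. (cmod (fourier m f \<phi>))\<^sup>2)"
    by simp
  then show ?thesis
    by (simp add: L2_norm_diff_square[OF f char_sum_L2[OF T(2)]] char_sum_norm[OF T])
qed

lemma Bessel:
  assumes "finite T" "T \<subseteq> dual_group" "f \<in> L2 m"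
  shows "(\<Sum>\<phi>\<in>T. (cmod (fourier m f \<phi>))\<^sup>2) \<le> (L2_norm m f)\<^sup>2"
  using char_sum_distance[OF assms] zero_le_power2[of "L2_norm m (\<lambda>x. f x - char_sum T (fourier m f) x)"]
  by linarith

lemma fourier_cong_AE:
  assumes "L2_eq m f g" "f \<in> L2 m" "g \<in> L2 m" "\<phi> \<in> dual_group"
  shows "fourier m f \<phi> = fourier m g \<phi>"
  unfolding fourier_eq_inner using L2_inner_cong_AE[OF assms(1-3) dual_group_L2[OF assms(4)]] .

lemma fourier_diff:
  assumes "f \<in> L2 m" "g \<in> L2 m" "\<phi> \<in> dual_group"
  shows "fourier m (\<lambda>x. f x - g x) \<phi> = fourier m f \<phi> - fourier m g \<phi>"
  unfolding fourier_eq_inner using L2_inner_diff_left[OF assms(1,2) dual_group_L2[OF assms(3)]] .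

lemma fourier_inject:
  assumes "f \<in> L2 m" "g \<in> L2 m" "\<And>\<phi>. \<phi> \<in> dual_group \<Longrightarrow> fourier m f \<phi> = fourier m g \<phi>"
  shows "L2_eq m f g"
proof -
  have "AE x in m. f x - g x = 0"
    using assms by (intro fourier_eq_0_imp_AE_0 L2_diff) (simp_all add: fourier_diff)
  then show ?thesis by (simp add: L2_eq_def)
qed

text \<open>
  The index set may be uncountable. An increasing sequence of finite sets \<open>T n\<close> that leaves out
  less than \<open>(1 / 4)\<^sup>n\<close> of the total mass is enough: the \<open>L\<^sup>2\<close>-distance of consecutive partial
  sums is then at most \<open>(1 / 2)\<^sup>n\<close>, and a coefficient outside all \<open>T n\<close> vanishes.
\<close>

lemma Riesz_Fischer:
  assumes S: "S \<subseteq> dual_group" and summ: "(\<lambda>\<phi>. (cmod (b \<phi>))\<^sup>2) summable_on S"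
  obtains g where "g \<in> L2 m" "\<And>\<phi>. \<phi> \<in> dual_group \<Longrightarrow> fourier m g \<phi> = (if \<phi> \<in> S then b \<phi> else 0)"
    "(L2_norm m g)\<^sup>2 = (\<Sum>\<^sub>\<infinity>\<phi>\<in>S. (cmod (b \<phi>))\<^sup>2)"
proof -
  let ?w = "\<lambda>\<phi>. (cmod (b \<phi>))\<^sup>2"
  define s where "s = infsum ?w S"
  have le_s: "sum ?w F \<le> s" if "finite F" "F \<subseteq> S" for F
    unfolding s_def using summ that by (intro finite_sum_le_infsum) auto
  have "\<exists>F. finite F \<and> F \<subseteq> S \<and> s - sum ?w F < (1 / 4) ^ n" for n
  proof -
    have "(?w has_sum s) S" unfolding s_def using summ by (rule has_sum_infsum)
    then obtain F where "finite F" "F \<subseteq> S" "dist (sum ?w F) s < (1 / 4) ^ n"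
      unfolding has_sum_def tendsto_iff eventually_finite_subsets_at_top
      by (metis order_refl zero_less_power zero_less_divide_1_iff zero_less_numeral)
    then show ?thesis by (intro exI[of _ F]) (auto simp: dist_real_def)
  qed
  then obtain F where F: "\<And>n. finite (F n)" "\<And>n. F n \<subseteq> S" "\<And>n. s - sum ?w (F n) < (1 / 4) ^ n" by metis
  define T where "T n = (\<Union>k\<le>n. F k)" for n
  have T: "finite (T n)" "T n \<subseteq> S" "T n \<subseteq> T (Suc n)" for n
    using F by (auto simp: T_def intro: le_SucI)
  have T_close: "s - sum ?w (T n) < (1 / 4) ^ n" for n
  proof -
    have "sum ?w (F n) \<le> sum ?w (T n)" using T by (intro sum_mono2) (auto simp: T_def)
    then show ?thesis using F(3)[of n] by linarith
  qed
  have TX: "T n \<subseteq> dual_group" for n using T(2) S by blast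
  define g where "g n = char_sum (T n) b" for n
  have g: "g n \<in> L2 m" for n unfolding g_def by (rule char_sum_L2[OF TX])
  have step: "L2_norm m (\<lambda>x. g (Suc n) x - g n x) \<le> (1 / 2) ^ n" for n
  proof (rule power2_le_imp_le)
    have "(\<lambda>x. g (Suc n) x - g n x) = char_sum (T (Suc n) - T n) b"
      unfolding g_def char_sum_def using T by (simp add: sum_diff)
    then have "(L2_norm m (\<lambda>x. g (Suc n) x - g n x))\<^sup>2 = sum ?w (T (Suc n) - T n)"
      using T TX[of "Suc n"] by (simp add: char_sum_norm subset_trans[OF Diff_subset])
    also have "\<dots> = sum ?w (T (Suc n)) - sum ?w (T n)" using T by (simp add: sum_diff)
    also have "\<dots> \<le> (1 / 4) ^ n" using le_s[OF T(1,2), of "Suc n"] T_close[of n] by linarith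
    also have "\<dots> = ((1 / 2) ^ n)\<^sup>2" by (simp add: power2_eq_square flip: power_mult_distrib)
    finally show "(L2_norm m (\<lambda>x. g (Suc n) x - g n x))\<^sup>2 \<le> ((1 / 2) ^ n)\<^sup>2" .
  qed simp
  obtain h where h: "h \<in> L2 m" "\<And>n. L2_norm m (\<lambda>x. h x - g n x) \<le> 2 * (1 / 2) ^ n"
    using L2_Cauchy_limit[OF g step] by blast
  have lim0: "(\<lambda>n. 2 * (1 / 2 :: real) ^ n) \<longlonglongrightarrow> 0"
    using tendsto_mult_right_zero[OF LIMSEQ_realpow_zero[of "1/2"]] by auto
  have h_lim: "(\<lambda>n. L2_norm m (\<lambda>x. h x - g n x)) \<longlonglongrightarrow> 0"
    by (rule tendsto_sandwich[OF _ _ tendsto_const lim0]) (use h(2) in auto)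
  have coeff: "fourier m h \<phi> = (if \<phi> \<in> S then b \<phi> else 0)" if \<phi>: "\<phi> \<in> dual_group" for \<phi>
  proof -
    let ?b = "if \<phi> \<in> S then b \<phi> else 0"
    have "(\<lambda>n. fourier m h \<phi> - fourier m (g n) \<phi>) \<longlonglongrightarrow> 0"
    proof (rule Lim_null_comparison[OF _ h_lim])
      have "cmod (fourier m h \<phi> - fourier m (g n) \<phi>) \<le> L2_norm m (\<lambda>x. h x - g n x)" for n
        using L2_Cauchy_Schwarz[OF L2_diff[OF h(1) g[of n]] dual_group_L2[OF \<phi>]]
          fourier_diff[OF h(1) g[of n] \<phi>]
        by (simp add: dual_group_L2_norm[OF \<phi>] fourier_eq_inner)
      then show "\<forall>\<^sub>F n in sequentially. cmod (fourier m h \<phi> - fourier m (g n) \<phi>) \<le> L2_norm m (\<lambda>x. h x - g n x)"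
        by simp
    qed
    moreover have "(\<lambda>n. fourier m (g n) \<phi> - ?b) \<longlonglongrightarrow> 0"
    proof (rule Lim_null_comparison[OF _ lim0])
      have "cmod (fourier m (g n) \<phi> - ?b) \<le> 2 * (1 / 2) ^ n" for n
      proof (cases "\<phi> \<in> S - T n")
        case True
        then have "?w \<phi> + sum ?w (T n) \<le> s" using le_s[of "insert \<phi> (T n)"] T[of n] by simp
        then have "(cmod (b \<phi>))\<^sup>2 \<le> (1 / 4) ^ n" using T_close[of n] by linarith
        also have "\<dots> = ((1 / 2) ^ n)\<^sup>2" by (simp add: power2_eq_square flip: power_mult_distrib)
        also have "\<dots> \<le> (2 * (1 / 2) ^ n)\<^sup>2" by (intro power_mono) auto
        finally have "cmod (b \<phi>) \<le> 2 * (1 / 2) ^ n" by (rule power2_le_imp_le) simp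
        then show ?thesis using True \<phi> T[of n] TX[of n] by (simp add: g_def fourier_char_sum)
      next
        case False
        then show ?thesis using \<phi> T[of n] TX[of n] by (auto simp: g_def fourier_char_sum)
      qed
      then show "\<forall>\<^sub>F n in sequentially. cmod (fourier m (g n) \<phi> - ?b) \<le> 2 * (1 / 2) ^ n" by simp
    qed
    ultimately have "(\<lambda>n. (fourier m h \<phi> - fourier m (g n) \<phi>) + (fourier m (g n) \<phi> - ?b)) \<longlonglongrightarrow> 0 + 0"
      by (rule tendsto_add)
    then show ?thesis by (simp add: LIMSEQ_const_iff)
  qed
  have "(L2_norm m h)\<^sup>2 = s"
  proof -
    have "\<bar>L2_norm m h - L2_norm m (g n)\<bar> \<le> L2_norm m (\<lambda>x. h x - g n x)" for n
      using L2_norm_triangle[OF L2_diff[OF h(1) g[of n]] L2_scale[OF g[of n], of "-1"]]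
        L2_norm_triangle[OF h(1) L2_diff[OF h(1) g[of n]]]
      by (simp add: L2_norm_scale[of m "-1" "g n", simplified])
    then have "(\<lambda>n. L2_norm m h - L2_norm m (g n)) \<longlonglongrightarrow> 0"
      by (intro Lim_null_comparison[OF _ h_lim]) simp
    then have "(\<lambda>n. L2_norm m h - (L2_norm m h - L2_norm m (g n))) \<longlonglongrightarrow> L2_norm m h - 0"
      by (intro tendsto_intros)
    then have "(\<lambda>n. (L2_norm m (g n))\<^sup>2) \<longlonglongrightarrow> (L2_norm m h)\<^sup>2"
      by (intro tendsto_power) simp
    moreover have "(\<lambda>n. (L2_norm m (g n))\<^sup>2) \<longlonglongrightarrow> s"
    proof -
      have "(\<lambda>n. s - sum ?w (T n)) \<longlonglongrightarrow> 0"
      proof (rule tendsto_sandwich[OF _ _ tendsto_const])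
        show "(\<lambda>n. (1 / 4 :: real) ^ n) \<longlonglongrightarrow> 0" by (rule LIMSEQ_realpow_zero) auto
        show "\<forall>\<^sub>F n in sequentially. 0 \<le> s - sum ?w (T n)" using le_s T by simp
        show "\<forall>\<^sub>F n in sequentially. s - sum ?w (T n) \<le> (1 / 4) ^ n"
          by (intro always_eventually allI less_imp_le T_close)
      qed
      then have "(\<lambda>n. s - (s - sum ?w (T n))) \<longlonglongrightarrow> s - 0" by (intro tendsto_intros)
      then show ?thesis using T(1) TX by (simp add: g_def char_sum_norm)
    qed
    ultimately show ?thesis using LIMSEQ_unique by blast
  qed
  then show ?thesis using that h(1) coeff by (simp add: s_def)
qed

text \<open>
  By Riesz-Fischer there is a \<open>g\<close> with the same coefficients as \<open>f\<close> for which the identity holds;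
  completeness of the characters gives \<open>f = g\<close> almost everywhere. The set \<open>S\<close> allows sums over
  \<open>Xplus R\<close> or \<open>Xminus R\<close> alone.
\<close>

lemma Parseval:
  assumes f: "f \<in> L2 m" and S: "S \<subseteq> dual_group" and zero: "\<And>\<phi>. \<phi> \<in> dual_group - S \<Longrightarrow> fourier m f \<phi> = 0"
  shows "((\<lambda>\<phi>. (cmod (fourier m f \<phi>))\<^sup>2) has_sum (L2_norm m f)\<^sup>2) S"
proof -
  have summ: "(\<lambda>\<phi>. (cmod (fourier m f \<phi>))\<^sup>2) summable_on S"
  proof (rule nonneg_bdd_above_summable_on)
    show "bdd_above (sum (\<lambda>\<phi>. (cmod (fourier m f \<phi>))\<^sup>2) ` {F. F \<subseteq> S \<and> finite F})"
      using Bessel f S by (intro bdd_aboveI2[of _ _ "(L2_norm m f)\<^sup>2"]) auto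
  qed simp
  obtain g where g: "g \<in> L2 m" "\<And>\<phi>. \<phi> \<in> dual_group \<Longrightarrow> fourier m g \<phi> = (if \<phi> \<in> S then fourier m f \<phi> else 0)"
      "(L2_norm m g)\<^sup>2 = (\<Sum>\<^sub>\<infinity>\<phi>\<in>S. (cmod (fourier m f \<phi>))\<^sup>2)"
    using Riesz_Fischer[OF S summ] by blast
  have "L2_eq m f g" using zero by (intro fourier_inject f g) (auto simp: g(2))
  then have "L2_norm m f = L2_norm m g" using f g(1) by (rule L2_norm_cong_AE)
  then show ?thesis using g(3) has_sum_infsum[OF summ] by simp
qed

lemma char_sum_tendsto:
  assumes f: "f \<in> L2 m" and S: "S \<subseteq> dual_group" and zero: "\<And>\<phi>. \<phi> \<in> dual_group - S \<Longrightarrow> fourier m f \<phi> = 0"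
  shows "((\<lambda>T. L2_norm m (\<lambda>x. f x - char_sum T (fourier m f) x)) \<longlongrightarrow> 0) (finite_subsets_at_top S)"
proof -
  have "((\<lambda>T. sqrt ((L2_norm m f)\<^sup>2 - (\<Sum>\<phi>\<in>T. (cmod (fourier m f \<phi>))\<^sup>2))) \<longlongrightarrow> sqrt ((L2_norm m f)\<^sup>2 - (L2_norm m f)\<^sup>2))
      (finite_subsets_at_top S)"
    using Parseval[OF assms] unfolding has_sum_def by (intro tendsto_intros)
  moreover have "\<forall>\<^sub>F T in finite_subsets_at_top S. sqrt ((L2_norm m f)\<^sup>2 - (\<Sum>\<phi>\<in>T. (cmod (fourier m f \<phi>))\<^sup>2))
      = L2_norm m (\<lambda>x. f x - char_sum T (fourier m f) x)"
  proof (rule eventually_finite_subsets_at_top_weakI)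
    fix T assume "finite T" "T \<subseteq> S"
    then show "sqrt ((L2_norm m f)\<^sup>2 - (\<Sum>\<phi>\<in>T. (cmod (fourier m f \<phi>))\<^sup>2))
      = L2_norm m (\<lambda>x. f x - char_sum T (fourier m f) x)"
      using char_sum_distance[of T f] S f by (intro real_sqrt_unique) auto
  qed
  ultimately show ?thesis by (simp add: tendsto_cong)
qed

end

section \<open>The ordered dual group\<close>

lemma one_in_dual: "1 \<in> dual_group"
  by (auto simp: dual_group_def one_fun_def)

lemma mult_in_dual: "\<phi> \<in> dual_group \<Longrightarrow> \<psi> \<in> dual_group \<Longrightarrow> \<phi> * \<psi> \<in> dual_group"
  by (auto simp: dual_group_def times_fun_def norm_mult mult_ac intro!: continuous_intros)

lemma cnj_in_dual: "\<phi> \<in> dual_group \<Longrightarrow> cnj \<circ> \<phi> \<in> dual_group"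
  by (auto simp: dual_group_def o_def intro!: continuous_intros)

lemma cnj_cnj_character: "cnj \<circ> (cnj \<circ> \<phi>) = \<phi>"
  by (simp add: fun_eq_iff)

lemma mult_cnj_character:
  assumes "\<phi> \<in> dual_group" shows "\<phi> * (cnj \<circ> \<phi>) = 1"
proof
  fix x
  show "(\<phi> * (cnj \<circ> \<phi>)) x = 1 x"
    using complex_norm_square[of "\<phi> x"] dual_group_norm[OF assms]
    by (simp add: times_fun_def one_fun_def)
qed

locale ordered_dual =
  fixes R :: "('g::topological_ab_group_add \<Rightarrow> complex) rel"
  assumes order: "dual_order R"
begin

lemma dual_order_refl: "\<phi> \<in> dual_group \<Longrightarrow> (\<phi>, \<phi>) \<in> R"
  using order by (auto simp: dual_order_def order_on_defs refl_on_def)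

lemma dual_order_trans: "(\<phi>, \<psi>) \<in> R \<Longrightarrow> (\<psi>, \<eta>) \<in> R \<Longrightarrow> (\<phi>, \<eta>) \<in> R"
  using order unfolding dual_order_def order_on_defs by (meson transD)

lemma dual_order_antisym: "(\<phi>, \<psi>) \<in> R \<Longrightarrow> (\<psi>, \<phi>) \<in> R \<Longrightarrow> \<phi> = \<psi>"
  using order unfolding dual_order_def order_on_defs by (meson antisymD)

lemma dual_order_total: "\<phi> \<in> dual_group \<Longrightarrow> \<psi> \<in> dual_group \<Longrightarrow> (\<phi>, \<psi>) \<in> R \<or> (\<psi>, \<phi>) \<in> R"
  using order dual_order_refl unfolding dual_order_def order_on_defs total_on_def by metis

lemma dual_order_mult:
  "(\<phi>, \<psi>) \<in> R \<Longrightarrow> \<phi> \<in> dual_group \<Longrightarrow> \<psi> \<in> dual_group \<Longrightarrow> \<eta> \<in> dual_group \<Longrightarrow> (\<phi> * \<eta>, \<psi> * \<eta>) \<in> R"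
  using order by (simp add: dual_order_def)

lemma Xplus_dual: "Xplus R \<subseteq> dual_group" and Xminus_dual: "Xminus R \<subseteq> dual_group"
  by (auto simp: Xplus_def Xminus_def)

lemma one_Xplus: "1 \<in> Xplus R"
  by (simp add: Xplus_def one_in_dual dual_order_refl)

lemma mult_Xplus:
  assumes \<phi>: "\<phi> \<in> Xplus R" and \<xi>: "\<xi> \<in> Xplus R - {1}"
  shows "\<phi> * \<xi> \<in> Xplus R - {1}"
proof -
  have dual: "\<phi> \<in> dual_group" "\<xi> \<in> dual_group" and le: "(1, \<phi>) \<in> R" "(1, \<xi>) \<in> R" and "\<xi> \<noteq> 1"
    using assms by (auto simp: Xplus_def)
  have "(\<phi>, \<phi> * \<xi>) \<in> R"
    using dual_order_mult[OF le(2) one_in_dual dual(2) dual(1)] by (simp add: mult.commute)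
  moreover from this have "(1, \<phi> * \<xi>) \<in> R" using le(1) dual_order_trans by blast
  moreover have "\<phi> * \<xi> \<noteq> 1"
  proof
    assume "\<phi> * \<xi> = 1"
    then have "\<phi> = 1" using \<open>(\<phi>, \<phi> * \<xi>) \<in> R\<close> le(1) dual_order_antisym by auto
    then show False using \<open>\<phi> * \<xi> = 1\<close> \<open>\<xi> \<noteq> 1\<close> by simp
  qed
  ultimately show ?thesis using dual by (simp add: Xplus_def mult_in_dual)
qed

lemma cnj_Xplus_in_Xminus:
  assumes "\<xi> \<in> Xplus R - {1}" shows "cnj \<circ> \<xi> \<in> Xminus R"
proof -
  have dual: "\<xi> \<in> dual_group" "cnj \<circ> \<xi> \<in> dual_group" and le: "(1, \<xi>) \<in> R" and ne: "\<xi> \<noteq> 1"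
    using assms by (auto simp: Xplus_def cnj_in_dual)
  have "(cnj \<circ> \<xi>, 1) \<in> R"
    using dual_order_mult[OF le one_in_dual dual] mult_cnj_character[OF dual(1)] by simp
  moreover have "cnj \<circ> \<xi> \<noteq> 1"
    using ne cnj_cnj_character[of \<xi>] by (auto simp: fun_eq_iff)
  ultimately have "(1, cnj \<circ> \<xi>) \<notin> R" using dual_order_antisym by blast
  then show ?thesis using dual by (simp add: Xminus_def Xplus_def)
qed

lemma cnj_Xminus_in_Xplus:
  assumes "\<psi> \<in> Xminus R" shows "cnj \<circ> \<psi> \<in> Xplus R - {1}"
proof -
  have dual: "\<psi> \<in> dual_group" "cnj \<circ> \<psi> \<in> dual_group" and "(1, \<psi>) \<notin> R"
    using assms by (auto simp: Xminus_def Xplus_def cnj_in_dual)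
  then have "(\<psi>, 1) \<in> R" and ne: "\<psi> \<noteq> 1" using dual_order_total one_in_dual dual_order_refl by auto
  then have "(1, cnj \<circ> \<psi>) \<in> R"
    using dual_order_mult[OF _ dual(1) one_in_dual dual(2)] mult_cnj_character[OF dual(1)] by simp
  moreover have "cnj \<circ> \<psi> \<noteq> 1"
    using ne cnj_cnj_character[of \<psi>] by (auto simp: fun_eq_iff)
  ultimately show ?thesis using dual by (simp add: Xplus_def)
qed

lemma bij_cnj_Xminus: "bij_betw (\<lambda>\<xi>. cnj \<circ> \<xi>) (Xplus R - {1}) (Xminus R)"
proof (rule bij_betw_byWitness[where f' = "\<lambda>\<psi>. cnj \<circ> \<psi>"])
  show "(\<lambda>\<xi>. cnj \<circ> \<xi>) ` (Xplus R - {1}) \<subseteq> Xminus R"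
    by (intro image_subsetI cnj_Xplus_in_Xminus)
  show "(\<lambda>\<psi>. cnj \<circ> \<psi>) ` Xminus R \<subseteq> Xplus R - {1}"
    by (intro image_subsetI cnj_Xminus_in_Xplus)
qed (simp_all add: cnj_cnj_character)

end

section \<open>Hardy spaces\<close>

locale hardy_space = compact_haar_group m + ordered_dual R
  for m :: "'g::{topological_ab_group_add, t2_space} measure" and R :: "('g \<Rightarrow> complex) rel"
begin

lemma H2_L2: "H2 m R \<subseteq> L2 m" and H2_minus_L2: "H2_minus m R \<subseteq> L2 m"
  by (auto simp: H2_def H2_minus_def)

lemma char_sum_H2:
  assumes "finite T" "T \<subseteq> Xplus R" shows "char_sum T c \<in> H2 m R"
proof -
  have "T \<subseteq> dual_group" using assms Xplus_dual by blast
  then show ?thesis using assms Xminus_dual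
    by (auto simp: H2_def char_sum_L2 fourier_char_sum Xminus_def)
qed

lemma char_span_eq: "char_span (Xplus R) = {char_sum T c | T c. finite T \<and> T \<subseteq> Xplus R}"
  by (simp add: char_span_def char_sum_def)

lemma Xplus_char_sum: "char_sum {\<phi>} (\<lambda>_. 1) = \<phi>"
  by (simp add: char_sum_def)

lemma Xplus_char_span: "Xplus R \<subseteq> char_span (Xplus R)"
proof
  fix \<phi> assume "\<phi> \<in> Xplus R"
  then show "\<phi> \<in> char_span (Xplus R)"
    unfolding char_span_eq using Xplus_char_sum[of \<phi>, symmetric] by blast
qed

text \<open>
  If the coefficients on \<open>Xplus R\<close> vanish, \<open>g\<close> is a limit of combinations of characters in
  \<open>Xminus R\<close>, each of which is orthogonal to \<open>H2\<close>. Hence membership in \<open>H2_minus\<close> can be read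
  off from the Fourier coefficients.
\<close>

lemma H2_minus_iff:
  "g \<in> H2_minus m R \<longleftrightarrow> g \<in> L2 m \<and> (\<forall>\<phi>\<in>Xplus R. fourier m g \<phi> = 0)"
proof safe
  assume g: "g \<in> H2_minus m R"
  then show "g \<in> L2 m" using H2_minus_L2 by blast
  fix \<phi> assume "\<phi> \<in> Xplus R"
  then have "\<phi> \<in> H2 m R"
    using char_sum_H2[of "{\<phi>}" "\<lambda>_. 1"] by (simp add: Xplus_char_sum)
  then show "fourier m g \<phi> = 0" using g by (simp add: H2_minus_def fourier_eq_inner)
next
  assume g: "g \<in> L2 m" and zero: "\<forall>\<phi>\<in>Xplus R. fourier m g \<phi> = 0"
  have "L2_inner m g h = 0" if h: "h \<in> H2 m R" for h
  proof -
    have hL: "h \<in> L2 m" using h by (simp add: H2_def)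
    have "cmod (L2_inner m g h) \<le> L2_norm m (\<lambda>x. g x - char_sum T (fourier m g) x) * L2_norm m h"
      if T: "finite T" "T \<subseteq> Xminus R" for T
    proof -
      have TX: "T \<subseteq> dual_group" using T Xminus_dual by blast
      have "L2_inner m (char_sum T (fourier m g)) h = 0"
        unfolding inner_char_sum_left[OF TX hL]
        using h T by (intro sum.neutral) (auto simp: H2_def fourier_eq_inner L2_inner_cnj[of m _ h])
      then have "L2_inner m g h = L2_inner m (\<lambda>x. g x - char_sum T (fourier m g) x) h"
        by (simp add: L2_inner_diff_left[OF g char_sum_L2[OF TX] hL])
      then show ?thesis using L2_Cauchy_Schwarz[OF L2_diff[OF g char_sum_L2[OF TX]] hL] by simp
    qed
    moreover have "((\<lambda>T. L2_norm m (\<lambda>x. g x - char_sum T (fourier m g) x) * L2_norm m h) \<longlongrightarrow> 0 * L2_norm m h)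
        (finite_subsets_at_top (Xminus R))"
      using zero by (intro tendsto_mult tendsto_const char_sum_tendsto g Xminus_dual) (auto simp: Xminus_def)
    ultimately have "cmod (L2_inner m g h) \<le> 0 * L2_norm m h"
      by (intro tendsto_lowerbound[of _ _ "finite_subsets_at_top (Xminus R)"])
        (auto intro!: eventually_finite_subsets_at_top_weakI)
    then show ?thesis by simp
  qed
  then show "g \<in> H2_minus m R" using g by (simp add: H2_minus_def)
qed

lemma H2_minus_eqI:
  assumes "f \<in> H2_minus m R" "g \<in> H2_minus m R"
    and "\<And>\<xi>. \<xi> \<in> Xplus R - {1} \<Longrightarrow> L2_inner m f (cnj \<circ> \<xi>) = L2_inner m g (cnj \<circ> \<xi>)"
  shows "L2_eq m f g"
proof (rule fourier_inject)
  fix \<phi> :: "'g \<Rightarrow> complex" assume \<phi>: "\<phi> \<in> dual_group"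
  show "fourier m f \<phi> = fourier m g \<phi>"
  proof (cases "\<phi> \<in> Xplus R")
    case True
    then show ?thesis using assms(1,2) by (simp add: H2_minus_iff)
  next
    case False
    then have "\<phi> \<in> Xminus R" using \<phi> by (simp add: Xminus_def)
    then show ?thesis using assms(3)[OF cnj_Xminus_in_Xplus]
      by (simp add: fourier_eq_inner cnj_cnj_character)
  qed
qed (use assms H2_minus_L2 in auto)

lemma H2_minus_Parseval:
  assumes "g \<in> H2_minus m R"
  shows "((\<lambda>\<xi>. (cmod (L2_inner m g (cnj \<circ> \<xi>)))\<^sup>2) has_sum (L2_norm m g)\<^sup>2) (Xplus R - {1})"
proof -
  have "((\<lambda>\<phi>. (cmod (fourier m g \<phi>))\<^sup>2) has_sum (L2_norm m g)\<^sup>2) (Xminus R)"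
    using assms by (intro Parseval Xminus_dual) (auto simp: H2_minus_iff Xminus_def)
  then show ?thesis
    by (subst (asm) has_sum_reindex_bij_betw[OF bij_cnj_Xminus, symmetric]) (simp add: fourier_eq_inner)
qed

lemma H2_minus_exists:
  assumes "(\<lambda>\<xi>. (cmod (b \<xi>))\<^sup>2) summable_on (Xplus R - {1})"
  obtains g where "g \<in> H2_minus m R" "\<And>\<xi>. \<xi> \<in> Xplus R - {1} \<Longrightarrow> L2_inner m g (cnj \<circ> \<xi>) = b \<xi>"
proof -
  have "(\<lambda>\<phi>. (cmod (b (cnj \<circ> \<phi>)))\<^sup>2) summable_on (Xminus R)"
    using assms by (subst summable_on_reindex_bij_betw[OF bij_cnj_Xminus, symmetric]) (simp add: cnj_cnj_character)
  then obtain g where g: "g \<in> L2 m"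
      "\<And>\<phi>. \<phi> \<in> dual_group \<Longrightarrow> fourier m g \<phi> = (if \<phi> \<in> Xminus R then b (cnj \<circ> \<phi>) else 0)"
    using Riesz_Fischer[OF Xminus_dual, of "\<lambda>\<phi>. b (cnj \<circ> \<phi>)"] by blast
  have "g \<in> H2_minus m R" using g Xplus_dual by (auto simp: H2_minus_iff Xminus_def)
  moreover have "L2_inner m g (cnj \<circ> \<xi>) = b \<xi>" if "\<xi> \<in> Xplus R - {1}" for \<xi>
    using cnj_Xplus_in_Xminus[OF that] g(2)[of "cnj \<circ> \<xi>"] Xminus_dual
    by (auto simp: fourier_eq_inner cnj_cnj_character)
  ultimately show ?thesis using that by blast
qed

lemma H2_Parseval:
  assumes "f \<in> H2 m R"
  shows "((\<lambda>\<phi>. (cmod (fourier m f \<phi>))\<^sup>2) has_sum (L2_norm m f)\<^sup>2) (Xplus R)"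
  using assms by (intro Parseval Xplus_dual) (auto simp: H2_def Xminus_def)

text \<open>
  Operators are additive and homogeneous only up to null sets, so compatibility with finite sums
  needs an induction; the empty sum is \<open>0\<close> times itself.
\<close>

lemma linear_op_char_sum:
  assumes D: "L2_subspace D" "char_span (Xplus R) \<subseteq> D" and A: "linear_op m D E A"
    and T: "finite T" "T \<subseteq> Xplus R"
  shows "L2_eq m (A (char_sum T c)) (\<lambda>x. \<Sum>\<phi>\<in>T. c \<phi> * A \<phi> x)"
  using T
proof (induction T)
  case empty
  have D0: "char_sum {} c \<in> D" using D(2) by (force simp: char_span_eq)
  have "L2_eq m (A (\<lambda>x. 0 * char_sum {} c x)) (\<lambda>x. 0 * A (char_sum {} c) x)"
    using A D0 unfolding linear_op_def by blast
  then show ?case by (simp add: char_sum_def)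
next
  case (insert \<phi> T)
  have in_D: "char_sum T c \<in> D" "\<phi> \<in> D" "(\<lambda>x. c \<phi> * \<phi> x) \<in> D"
  proof -
    show "char_sum T c \<in> D" using D(2) insert by (force simp: char_span_eq)
    show "\<phi> \<in> D" using Xplus_char_span D(2) insert by blast
    then show "(\<lambda>x. c \<phi> * \<phi> x) \<in> D" using D(1) by (simp add: L2_subspace_def)
  qed
  have "char_sum (insert \<phi> T) c = (\<lambda>x. c \<phi> * \<phi> x) + char_sum T c"
    using insert by (simp add: char_sum_def plus_fun_def)
  then have "L2_eq m (A (char_sum (insert \<phi> T) c)) (A (\<lambda>x. c \<phi> * \<phi> x) + A (char_sum T c))"
    using A in_D unfolding linear_op_def by simp
  moreover have "L2_eq m (A (\<lambda>x. c \<phi> * \<phi> x)) (\<lambda>x. c \<phi> * A \<phi> x)"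
    using A in_D unfolding linear_op_def by blast
  moreover have "L2_eq m (A (char_sum T c)) (\<lambda>x. \<Sum>\<phi>\<in>T. c \<phi> * A \<phi> x)"
    using insert by simp
  ultimately show ?case unfolding L2_eq_def
  proof eventually_elim
    case (elim x)
    then show ?case using insert(1,2) by simp
  qed
qed

end

section \<open>Hankel operators with a square-summable semi-character\<close>

lemma ell2_norm_square:
  assumes "ell2 S a" shows "((\<lambda>s. (cmod (a s))\<^sup>2) has_sum (ell2_norm S a)\<^sup>2) S"
  using has_sum_infsum[OF assms[unfolded ell2_def]] by (simp add: ell2_norm_def infsum_nonneg)

lemma ell2_finite_sum_le:
  assumes "ell2 S a" "finite F" "F \<subseteq> S" shows "(\<Sum>s\<in>F. (cmod (a s))\<^sup>2) \<le> (ell2_norm S a)\<^sup>2"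
  using ell2_norm_square[OF assms(1)] assms by (intro has_sum_mono_neutral[OF has_sum_finite[of F]]) auto

lemma ell2I:
  assumes "\<And>F. finite F \<Longrightarrow> F \<subseteq> S \<Longrightarrow> (\<Sum>s\<in>F. (cmod (a s))\<^sup>2) \<le> C"
  shows "ell2 S a"
  unfolding ell2_def
  by (rule nonneg_bdd_above_summable_on) (use assms in \<open>auto intro!: bdd_aboveI2[where M = C]\<close>)

lemma linear_op_into: "linear_op m D E A \<Longrightarrow> f \<in> D \<Longrightarrow> A f \<in> E"
  by (simp add: linear_op_def)

context hardy_space
begin

lemma mu_hankel_into:
  assumes "mu_hankel m R \<mu> a D A" "f \<in> char_span (Xplus R)" shows "A f \<in> H2_minus m R"
proof -
  have "linear_op m D (H2_minus m R) A" "f \<in> D" using assms by (auto simp: mu_hankel_def)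
  then show ?thesis by (rule linear_op_into)
qed

text \<open>
  The shift \<open>\<xi> \<mapsto> \<phi> * \<xi>\<close> is injective and stays inside \<open>Xplus R - {1}\<close>, so the sum runs over
  distinct values of \<open>a\<close>.
\<close>

lemma shift_sum_le:
  assumes a: "ell2 (Xplus R - {1}) a" and F: "finite F" "F \<subseteq> Xplus R - {1}" and \<phi>: "\<phi> \<in> Xplus R"
  shows "(\<Sum>\<xi>\<in>F. (cmod (a (\<phi> * \<xi>)))\<^sup>2) \<le> (ell2_norm (Xplus R - {1}) a)\<^sup>2"
proof -
  have \<phi>': "\<phi> \<in> dual_group" using \<phi> Xplus_dual by blast
  have inj: "inj_on (\<lambda>\<xi>. \<phi> * \<xi>) F"
  proof (rule inj_onI)
    fix \<xi> \<eta> assume "\<phi> * \<xi> = \<phi> * \<eta>"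
    then have "(\<phi> * (cnj \<circ> \<phi>)) * \<xi> = (\<phi> * (cnj \<circ> \<phi>)) * \<eta>"
      by (metis mult.assoc mult.commute)
    then show "\<xi> = \<eta>" by (simp add: mult_cnj_character[OF \<phi>'])
  qed
  have "(\<Sum>\<xi>\<in>F. (cmod (a (\<phi> * \<xi>)))\<^sup>2) = (\<Sum>\<eta>\<in>(\<lambda>\<xi>. \<phi> * \<xi>) ` F. (cmod (a \<eta>))\<^sup>2)"
    by (simp add: sum.reindex[OF inj])
  also have "\<dots> \<le> (ell2_norm (Xplus R - {1}) a)\<^sup>2"
    using F \<phi> by (intro ell2_finite_sum_le[OF a] finite_imageI image_subsetI mult_Xplus) auto
  finally show ?thesis .
qed

text \<open>
  The matrix is applied to the sequence \<open>c\<close> of norm \<open>N\<close>. On finite blocks this is the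
  Cauchy-Schwarz inequality followed by an exchange of two finite sums; passing to the limit in
  the inner sum, with the outer one still finite, avoids exchanging infinite sums.
\<close>

lemma Hilbert_Schmidt_bound:
  assumes \<mu>: "ell2 (Xplus R) \<mu>" and a: "ell2 (Xplus R - {1}) a"
    and c: "((\<lambda>\<phi>. (cmod (c \<phi>))\<^sup>2) has_sum N\<^sup>2) (Xplus R)"
    and s: "\<And>\<xi>. \<xi> \<in> Xplus R - {1} \<Longrightarrow> ((\<lambda>\<phi>. c \<phi> * (\<mu> \<phi> * a (\<phi> * \<xi>))) has_sum s \<xi>) (Xplus R)"
    and F: "finite F" "F \<subseteq> Xplus R - {1}"
  shows "(\<Sum>\<xi>\<in>F. (cmod (s \<xi>))\<^sup>2) \<le> (ell2_norm (Xplus R) \<mu> * ell2_norm (Xplus R - {1}) a * N)\<^sup>2"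
proof -
  let ?M = "ell2_norm (Xplus R) \<mu>" and ?A = "ell2_norm (Xplus R - {1}) a"
  have bound: "(\<Sum>\<xi>\<in>F. (cmod (\<Sum>\<phi>\<in>E. c \<phi> * (\<mu> \<phi> * a (\<phi> * \<xi>))))\<^sup>2) \<le> (?M * ?A * N)\<^sup>2"
    if E: "finite E" "E \<subseteq> Xplus R" for E
  proof -
    have cN: "(\<Sum>\<phi>\<in>E. (cmod (c \<phi>))\<^sup>2) \<le> N\<^sup>2"
      using c E by (intro has_sum_mono_neutral[OF has_sum_finite[of E]]) auto
    have "(\<Sum>\<xi>\<in>F. (cmod (\<Sum>\<phi>\<in>E. c \<phi> * (\<mu> \<phi> * a (\<phi> * \<xi>))))\<^sup>2)
        \<le> (\<Sum>\<xi>\<in>F. N\<^sup>2 * (\<Sum>\<phi>\<in>E. (cmod (\<mu> \<phi>))\<^sup>2 * (cmod (a (\<phi> * \<xi>)))\<^sup>2))"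
    proof (rule sum_mono)
      fix \<xi>
      have "cmod (\<Sum>\<phi>\<in>E. c \<phi> * (\<mu> \<phi> * a (\<phi> * \<xi>))) \<le> (\<Sum>\<phi>\<in>E. cmod (c \<phi>) * cmod (\<mu> \<phi> * a (\<phi> * \<xi>)))"
        by (rule order_trans[OF norm_sum]) (simp add: norm_mult)
      then have "(cmod (\<Sum>\<phi>\<in>E. c \<phi> * (\<mu> \<phi> * a (\<phi> * \<xi>))))\<^sup>2
          \<le> (\<Sum>\<phi>\<in>E. cmod (c \<phi>) * cmod (\<mu> \<phi> * a (\<phi> * \<xi>)))\<^sup>2"
        by (rule power_mono) simp
      also have "\<dots> \<le> (\<Sum>\<phi>\<in>E. (cmod (c \<phi>))\<^sup>2) * (\<Sum>\<phi>\<in>E. (cmod (\<mu> \<phi> * a (\<phi> * \<xi>)))\<^sup>2)"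
        by (rule Cauchy_Schwarz_ineq_sum)
      also have "\<dots> \<le> N\<^sup>2 * (\<Sum>\<phi>\<in>E. (cmod (\<mu> \<phi> * a (\<phi> * \<xi>)))\<^sup>2)"
        by (intro mult_right_mono cN sum_nonneg) auto
      finally show "(cmod (\<Sum>\<phi>\<in>E. c \<phi> * (\<mu> \<phi> * a (\<phi> * \<xi>))))\<^sup>2
          \<le> N\<^sup>2 * (\<Sum>\<phi>\<in>E. (cmod (\<mu> \<phi>))\<^sup>2 * (cmod (a (\<phi> * \<xi>)))\<^sup>2)"
        by (simp add: norm_mult power_mult_distrib)
    qed
    also have "\<dots> = N\<^sup>2 * (\<Sum>\<xi>\<in>F. \<Sum>\<phi>\<in>E. (cmod (\<mu> \<phi>))\<^sup>2 * (cmod (a (\<phi> * \<xi>)))\<^sup>2)"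
      by (simp add: sum_distrib_left)
    also have "\<dots> = N\<^sup>2 * (\<Sum>\<phi>\<in>E. (cmod (\<mu> \<phi>))\<^sup>2 * (\<Sum>\<xi>\<in>F. (cmod (a (\<phi> * \<xi>)))\<^sup>2))"
      by (subst sum.swap) (simp add: sum_distrib_left)
    also have "\<dots> \<le> N\<^sup>2 * (\<Sum>\<phi>\<in>E. (cmod (\<mu> \<phi>))\<^sup>2 * ?A\<^sup>2)"
      using E by (intro mult_left_mono sum_mono shift_sum_le[OF a F]) auto
    also have "\<dots> = N\<^sup>2 * ((\<Sum>\<phi>\<in>E. (cmod (\<mu> \<phi>))\<^sup>2) * ?A\<^sup>2)"
      by (simp add: sum_distrib_right)
    also have "\<dots> \<le> N\<^sup>2 * (?M\<^sup>2 * ?A\<^sup>2)"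
      by (intro mult_left_mono mult_right_mono ell2_finite_sum_le[OF \<mu> E]) auto
    also have "\<dots> = (?M * ?A * N)\<^sup>2" by (simp add: power_mult_distrib)
    finally show ?thesis .
  qed
  show ?thesis
  proof (rule tendsto_upperbound)
    show "((\<lambda>E. \<Sum>\<xi>\<in>F. (cmod (\<Sum>\<phi>\<in>E. c \<phi> * (\<mu> \<phi> * a (\<phi> * \<xi>))))\<^sup>2) \<longlongrightarrow> (\<Sum>\<xi>\<in>F. (cmod (s \<xi>))\<^sup>2))
        (finite_subsets_at_top (Xplus R))"
      using F(2) by (intro tendsto_sum tendsto_power tendsto_norm s[unfolded has_sum_def]) auto
    show "\<forall>\<^sub>F E in finite_subsets_at_top (Xplus R).
        (\<Sum>\<xi>\<in>F. (cmod (\<Sum>\<phi>\<in>E. c \<phi> * (\<mu> \<phi> * a (\<phi> * \<xi>))))\<^sup>2) \<le> (?M * ?A * N)\<^sup>2"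
      by (rule eventually_finite_subsets_at_top_weakI) (rule bound)
  qed simp
qed

text \<open>
  The values of \<open>a\<close> are bounded by its norm, and \<open>\<bar>c \<phi> * \<mu> \<phi>\<bar> \<le> \<bar>c \<phi>\<bar>\<^sup>2 + \<bar>\<mu> \<phi>\<bar>\<^sup>2\<close>.
\<close>

lemma hankel_row_summable:
  assumes \<mu>: "ell2 (Xplus R) \<mu>" and a: "ell2 (Xplus R - {1}) a" and c: "ell2 (Xplus R) c"
    and \<xi>: "\<xi> \<in> Xplus R - {1}"
  shows "(\<lambda>\<phi>. c \<phi> * (\<mu> \<phi> * a (\<phi> * \<xi>))) summable_on Xplus R"
proof -
  let ?A = "ell2_norm (Xplus R - {1}) a"
  have "0 \<le> ?A" by (simp add: ell2_norm_def infsum_nonneg)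
  have "(\<lambda>\<phi>. ?A * ((cmod (c \<phi>))\<^sup>2 + (cmod (\<mu> \<phi>))\<^sup>2)) summable_on Xplus R"
    using \<mu> c unfolding ell2_def by (intro summable_on_cmult_right summable_on_add)
  then have "(\<lambda>\<phi>. norm (c \<phi> * (\<mu> \<phi> * a (\<phi> * \<xi>)))) summable_on Xplus R"
  proof (rule summable_on_comparison_test)
    fix \<phi> assume \<phi>: "\<phi> \<in> Xplus R"
    have "(cmod (a (\<phi> * \<xi>)))\<^sup>2 \<le> ?A\<^sup>2"
      using shift_sum_le[OF a, of "{\<xi>}" \<phi>] \<phi> \<xi> by simp
    then have "cmod (a (\<phi> * \<xi>)) \<le> ?A" using \<open>0 \<le> ?A\<close> by (rule power2_le_imp_le)
    moreover have "cmod (c \<phi>) * cmod (\<mu> \<phi>) \<le> (cmod (c \<phi>))\<^sup>2 + (cmod (\<mu> \<phi>))\<^sup>2"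
    proof -
      have "2 * (cmod (c \<phi>) * cmod (\<mu> \<phi>)) \<le> (cmod (c \<phi>))\<^sup>2 + (cmod (\<mu> \<phi>))\<^sup>2"
        using sum_squares_bound[of "cmod (c \<phi>)" "cmod (\<mu> \<phi>)"] by simp
      moreover have "0 \<le> cmod (c \<phi>) * cmod (\<mu> \<phi>)" by simp
      ultimately show ?thesis by linarith
    qed
    ultimately have "cmod (a (\<phi> * \<xi>)) * (cmod (c \<phi>) * cmod (\<mu> \<phi>)) \<le> ?A * ((cmod (c \<phi>))\<^sup>2 + (cmod (\<mu> \<phi>))\<^sup>2)"
      using \<open>0 \<le> ?A\<close> by (intro mult_mono) auto
    then show "norm (c \<phi> * (\<mu> \<phi> * a (\<phi> * \<xi>))) \<le> ?A * ((cmod (c \<phi>))\<^sup>2 + (cmod (\<mu> \<phi>))\<^sup>2)"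
      by (simp add: norm_mult mult_ac)
  qed simp
  then show ?thesis by (rule abs_summable_summable)
qed

lemma H2_ell2_fourier: "f \<in> H2 m R \<Longrightarrow> ell2 (Xplus R) (fourier m f)"
  using H2_Parseval unfolding ell2_def summable_on_def by blast

lemma character_L2_cnj: "\<xi> \<in> Xplus R - {1} \<Longrightarrow> cnj \<circ> \<xi> \<in> L2 m"
  using cnj_Xplus_in_Xminus Xminus_dual dual_group_L2 by blast

lemma mu_hankel_char_sum:
  assumes A: "mu_hankel m R \<mu> a D A" and T: "finite T" "T \<subseteq> Xplus R" and \<xi>: "\<xi> \<in> Xplus R - {1}"
  shows "L2_inner m (A (char_sum T c)) (cnj \<circ> \<xi>) = (\<Sum>\<phi>\<in>T. c \<phi> * (\<mu> \<phi> * a (\<phi> * \<xi>)))"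
proof -
  have D: "L2_subspace D" "char_span (Xplus R) \<subseteq> D" and lin: "linear_op m D (H2_minus m R) A"
    and coeff: "\<And>\<phi>. \<phi> \<in> Xplus R \<Longrightarrow> L2_inner m (A \<phi>) (cnj \<circ> \<xi>) = \<mu> \<phi> * a (\<phi> * \<xi>)"
    using A \<xi> unfolding mu_hankel_def by blast+
  have A_L2: "f \<in> D \<Longrightarrow> A f \<in> L2 m" for f using linear_op_into[OF lin] H2_minus_L2 by blast
  have A\<phi>: "\<phi> \<in> Xplus R \<Longrightarrow> A \<phi> \<in> L2 m" for \<phi>
    using A_L2 Xplus_char_span D(2) by blast
  have "char_sum T c \<in> D" using D(2) T by (auto simp: char_span_eq)
  then have "L2_inner m (A (char_sum T c)) (cnj \<circ> \<xi>) = L2_inner m (\<lambda>x. \<Sum>\<phi>\<in>T. c \<phi> * A \<phi> x) (cnj \<circ> \<xi>)"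
    using T by (intro L2_inner_cong_AE[OF linear_op_char_sum[OF D lin T] A_L2] L2_sum L2_scale A\<phi> character_L2_cnj[OF \<xi>]) auto
  also have "\<dots> = (\<Sum>\<phi>\<in>T. L2_inner m (\<lambda>x. c \<phi> * A \<phi> x) (cnj \<circ> \<xi>))"
    using T by (intro L2_inner_sum_left L2_scale A\<phi> character_L2_cnj[OF \<xi>]) auto
  also have "\<dots> = (\<Sum>\<phi>\<in>T. c \<phi> * (\<mu> \<phi> * a (\<phi> * \<xi>)))"
    using T by (intro sum.cong refl) (simp add: L2_inner_scale_left coeff subsetD)
  finally show ?thesis .
qed

text \<open>
  On the partial sums of the Fourier series of \<open>f\<close> the extension agrees with \<open>A\<close>, whose
  coefficients are the partial sums on the left. Those Fourier sums converge to \<open>f\<close> in \<open>L\<^sup>2\<close>, and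
  \<open>B\<close> is continuous. Both uniqueness and the norm bound rest on this formula.
\<close>

lemma bounded_extension_coeff:
  assumes A: "mu_hankel m R \<mu> a D A" and B: "bounded_extension m R A B"
    and f: "f \<in> H2 m R" and \<xi>: "\<xi> \<in> Xplus R - {1}"
  shows "((\<lambda>\<phi>. fourier m f \<phi> * (\<mu> \<phi> * a (\<phi> * \<xi>))) has_sum L2_inner m (B f) (cnj \<circ> \<xi>)) (Xplus R)"
proof -
  let ?P = "\<lambda>T. char_sum T (fourier m f)"
  have lin: "linear_op m (H2 m R) (H2_minus m R) B"
    using B by (simp add: bounded_extension_def bounded_op_def)
  obtain C where C: "\<And>f. f \<in> H2 m R \<Longrightarrow> L2_norm m (B f) \<le> C * L2_norm m f"
    using B unfolding bounded_extension_def bounded_op_def by blast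
  have BL2: "g \<in> H2 m R \<Longrightarrow> B g \<in> L2 m" for g using linear_op_into[OF lin] H2_minus_L2 by blast
  have fL2: "f \<in> L2 m" using f H2_L2 by blast
  have \<xi>L2: "cnj \<circ> \<xi> \<in> L2 m" by (rule character_L2_cnj[OF \<xi>])
  have close: "cmod ((\<Sum>\<phi>\<in>T. fourier m f \<phi> * (\<mu> \<phi> * a (\<phi> * \<xi>))) - L2_inner m (B f) (cnj \<circ> \<xi>))
      \<le> C * L2_norm m (\<lambda>x. f x - ?P T x) * L2_norm m (cnj \<circ> \<xi>)"
    if T: "finite T" "T \<subseteq> Xplus R" for T
  proof -
    have PT: "?P T \<in> H2 m R" "?P T \<in> char_span (Xplus R)"
      using T by (auto simp: char_sum_H2 char_span_eq)
    have PL2: "?P T \<in> L2 m" using PT H2_L2 by blast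
    have AP: "A (?P T) \<in> L2 m"
      using mu_hankel_into[OF A PT(2)] H2_minus_L2 by blast
    let ?d = "\<lambda>x. f x - ?P T x"
    have d: "?d \<in> H2 m R"
    proof -
      have "fourier m ?d \<phi> = 0" if "\<phi> \<in> Xminus R" for \<phi>
        using fourier_diff[OF fL2 PL2, of \<phi>] f PT(1) that Xminus_dual by (auto simp: H2_def)
      then show ?thesis by (simp add: H2_def L2_diff fL2 PL2)
    qed
    have "f = ?d + ?P T" by (simp add: plus_fun_def)
    moreover have "L2_eq m (B (?d + ?P T)) (B ?d + B (?P T))"
      using lin d PT(1) unfolding linear_op_def by blast
    ultimately have "L2_eq m (B f) (B ?d + B (?P T))" by simp
    then have "L2_inner m (B f) (cnj \<circ> \<xi>) = L2_inner m (B ?d + B (?P T)) (cnj \<circ> \<xi>)"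
      using L2_add[OF BL2[OF d] BL2[OF PT(1)]]
      by (intro L2_inner_cong_AE BL2 f \<xi>L2) (auto simp: plus_fun_def)
    also have "\<dots> = L2_inner m (B ?d) (cnj \<circ> \<xi>) + L2_inner m (B (?P T)) (cnj \<circ> \<xi>)"
      unfolding plus_fun_def by (intro L2_inner_add_left BL2 d PT \<xi>L2)
    also have "L2_inner m (B (?P T)) (cnj \<circ> \<xi>) = L2_inner m (A (?P T)) (cnj \<circ> \<xi>)"
      using B PT by (intro L2_inner_cong_AE BL2 AP \<xi>L2) (auto simp: bounded_extension_def)
    also have "\<dots> = (\<Sum>\<phi>\<in>T. fourier m f \<phi> * (\<mu> \<phi> * a (\<phi> * \<xi>)))"
      by (rule mu_hankel_char_sum[OF A T \<xi>])
    finally have eq: "L2_inner m (B f) (cnj \<circ> \<xi>)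
        = L2_inner m (B ?d) (cnj \<circ> \<xi>) + (\<Sum>\<phi>\<in>T. fourier m f \<phi> * (\<mu> \<phi> * a (\<phi> * \<xi>)))" .
    have "cmod ((\<Sum>\<phi>\<in>T. fourier m f \<phi> * (\<mu> \<phi> * a (\<phi> * \<xi>))) - L2_inner m (B f) (cnj \<circ> \<xi>))
        = cmod (L2_inner m (B ?d) (cnj \<circ> \<xi>))" unfolding eq by simp
    also have "\<dots> \<le> L2_norm m (B ?d) * L2_norm m (cnj \<circ> \<xi>)"
      by (intro L2_Cauchy_Schwarz BL2 d \<xi>L2)
    also have "\<dots> \<le> C * L2_norm m ?d * L2_norm m (cnj \<circ> \<xi>)"
      by (intro mult_right_mono C d) simp
    finally show ?thesis .
  qed
  have lim: "((\<lambda>T. C * L2_norm m (\<lambda>x. f x - ?P T x) * L2_norm m (cnj \<circ> \<xi>)) \<longlongrightarrow> C * 0 * L2_norm m (cnj \<circ> \<xi>))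
      (finite_subsets_at_top (Xplus R))"
    using f by (intro tendsto_mult tendsto_const char_sum_tendsto fL2 Xplus_dual) (auto simp: H2_def Xminus_def)
  show ?thesis
    unfolding has_sum_def
  proof (rule LIM_zero_cancel, rule Lim_null_comparison)
    show "((\<lambda>T. C * L2_norm m (\<lambda>x. f x - ?P T x) * L2_norm m (cnj \<circ> \<xi>)) \<longlongrightarrow> 0) (finite_subsets_at_top (Xplus R))"
      using lim by simp
    show "\<forall>\<^sub>F T in finite_subsets_at_top (Xplus R).
        cmod ((\<Sum>\<phi>\<in>T. fourier m f \<phi> * (\<mu> \<phi> * a (\<phi> * \<xi>))) - L2_inner m (B f) (cnj \<circ> \<xi>))
        \<le> C * L2_norm m (\<lambda>x. f x - ?P T x) * L2_norm m (cnj \<circ> \<xi>)"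
      by (rule eventually_finite_subsets_at_top_weakI) (rule close)
  qed
qed

lemma H2_minus_norm_le:
  assumes \<mu>: "ell2 (Xplus R) \<mu>" and a: "ell2 (Xplus R - {1}) a"
    and f: "f \<in> H2 m R" and g: "g \<in> H2_minus m R"
    and s: "\<And>\<xi>. \<xi> \<in> Xplus R - {1} \<Longrightarrow>
      ((\<lambda>\<phi>. fourier m f \<phi> * (\<mu> \<phi> * a (\<phi> * \<xi>))) has_sum L2_inner m g (cnj \<circ> \<xi>)) (Xplus R)"
  shows "L2_norm m g \<le> ell2_norm (Xplus R) \<mu> * ell2_norm (Xplus R - {1}) a * L2_norm m f"
proof (rule power2_le_imp_le)
  show "(L2_norm m g)\<^sup>2 \<le> (ell2_norm (Xplus R) \<mu> * ell2_norm (Xplus R - {1}) a * L2_norm m f)\<^sup>2"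
    using Hilbert_Schmidt_bound[OF \<mu> a H2_Parseval[OF f] s]
    by (intro has_sum_le_finite_sums[OF H2_minus_Parseval[OF g]]) auto
  show "0 \<le> ell2_norm (Xplus R) \<mu> * ell2_norm (Xplus R - {1}) a * L2_norm m f"
    by (simp add: ell2_norm_def infsum_nonneg)
qed

text \<open>
  The coefficients of \<open>A 1\<close> are the values of \<open>a\<close>, so they are square summable by Parseval.
\<close>

lemma ell2_of_mu_hankel:
  assumes A: "mu_hankel m R \<mu> a D A" and \<mu>: "\<mu> 1 = 1"
  shows "ell2 (Xplus R - {1}) a"
proof -
  have A1: "A 1 \<in> H2_minus m R" using mu_hankel_into[OF A] Xplus_char_span one_Xplus by blast
  have eq: "L2_inner m (A 1) (cnj \<circ> \<xi>) = a \<xi>" if "\<xi> \<in> Xplus R - {1}" for \<xi>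
    using A that one_Xplus \<mu> unfolding mu_hankel_def by (metis mult_1)
  have "((\<lambda>\<xi>. (cmod (a \<xi>))\<^sup>2) has_sum (L2_norm m (A 1))\<^sup>2) (Xplus R - {1})"
    using H2_minus_Parseval[OF A1] by (rule has_sum_cong[THEN iffD1, rotated]) (simp only: eq)
  then show ?thesis unfolding ell2_def summable_on_def by blast
qed

text \<open>
  \<open>B f\<close> is chosen as some element of \<open>H2_minus\<close> with the coefficients \<open>s (fourier m f)\<close>. It is
  unique up to a null set, so each property that \<open>B\<close> must have almost everywhere is an identity
  between coefficients.
\<close>

lemma bounded_extension_exists:
  assumes A: "mu_hankel m R \<mu> a D A" and \<mu>: "ell2 (Xplus R) \<mu>" and a: "ell2 (Xplus R - {1}) a"
  obtains B where "bounded_extension m R A B"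
proof -
  let ?Q = "Xplus R - {1}"
  define s where "s c \<xi> = (\<Sum>\<^sub>\<infinity>\<phi>\<in>Xplus R. c \<phi> * (\<mu> \<phi> * a (\<phi> * \<xi>)))" for c \<xi>
  have s_sum: "((\<lambda>\<phi>. fourier m f \<phi> * (\<mu> \<phi> * a (\<phi> * \<xi>))) has_sum s (fourier m f) \<xi>) (Xplus R)"
    if "f \<in> H2 m R" "\<xi> \<in> ?Q" for f \<xi>
    unfolding s_def using that by (intro has_sum_infsum hankel_row_summable \<mu> a H2_ell2_fourier)
  have "\<exists>g. g \<in> H2_minus m R \<and> (\<forall>\<xi>\<in>?Q. L2_inner m g (cnj \<circ> \<xi>) = s (fourier m f) \<xi>)"
    if f: "f \<in> H2 m R" for f
  proof -
    have "ell2 ?Q (s (fourier m f))"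
      using Hilbert_Schmidt_bound[OF \<mu> a H2_Parseval[OF f] s_sum[OF f]] by (intro ell2I) auto
    then show ?thesis unfolding ell2_def using H2_minus_exists by metis
  qed
  then obtain B where B: "\<And>f. f \<in> H2 m R \<Longrightarrow> B f \<in> H2_minus m R"
      "\<And>f \<xi>. f \<in> H2 m R \<Longrightarrow> \<xi> \<in> ?Q \<Longrightarrow> L2_inner m (B f) (cnj \<circ> \<xi>) = s (fourier m f) \<xi>"
    by metis
  have BL2: "f \<in> H2 m R \<Longrightarrow> B f \<in> L2 m" for f using B(1) H2_minus_L2 by blast
  have B_sum: "((\<lambda>\<phi>. fourier m f \<phi> * (\<mu> \<phi> * a (\<phi> * \<xi>))) has_sum L2_inner m (B f) (cnj \<circ> \<xi>)) (Xplus R)"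
    if "f \<in> H2 m R" "\<xi> \<in> ?Q" for f \<xi>
    using s_sum[OF that] B(2)[OF that] by simp
  have H2_minus_add: "(\<lambda>x. g x + h x) \<in> H2_minus m R" if "g \<in> H2_minus m R" "h \<in> H2_minus m R" for g h
    using that Xplus_dual by (auto simp: H2_minus_iff L2_add fourier_eq_inner L2_inner_add_left dual_group_L2 subsetD)
  have H2_minus_scale: "(\<lambda>x. k * g x) \<in> H2_minus m R" if "g \<in> H2_minus m R" for g k
    using that by (auto simp: H2_minus_iff L2_scale fourier_eq_inner L2_inner_scale_left)
  have H2_add: "(\<lambda>x. f x + g x) \<in> H2 m R" if "f \<in> H2 m R" "g \<in> H2 m R" for f g
    using that Xminus_dual by (auto simp: H2_def L2_add fourier_eq_inner L2_inner_add_left dual_group_L2 subsetD)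
  have H2_scale: "(\<lambda>x. k * f x) \<in> H2 m R" if "f \<in> H2 m R" for f k
    using that by (auto simp: H2_def L2_scale fourier_eq_inner L2_inner_scale_left)
  have "linear_op m (H2 m R) (H2_minus m R) B"
    unfolding linear_op_def
  proof (intro conjI ballI allI impI)
    fix f g assume f: "f \<in> H2 m R" and g: "g \<in> H2 m R"
    have fg: "f \<in> L2 m" "g \<in> L2 m" using f g H2_L2 by auto
    {
      assume "L2_eq m f g"
      then have "fourier m f \<phi> = fourier m g \<phi>" if "\<phi> \<in> Xplus R" for \<phi>
        using fg that Xplus_dual by (intro fourier_cong_AE) auto
      then have "s (fourier m f) = s (fourier m g)"
        unfolding s_def fun_eq_iff by (auto intro!: infsum_cong)
      then show "L2_eq m (B f) (B g)"
        by (intro H2_minus_eqI B(1) f g) (simp add: B(2) f g)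
    }
    have sum: "f + g \<in> H2 m R" using H2_add[OF f g] by (simp add: plus_fun_def)
    show "L2_eq m (B (f + g)) (B f + B g)"
    proof (rule H2_minus_eqI)
      show "B (f + g) \<in> H2_minus m R" by (rule B(1)[OF sum])
      show "B f + B g \<in> H2_minus m R" using H2_minus_add[OF B(1)[OF f] B(1)[OF g]] by (simp add: plus_fun_def)
      fix \<xi> assume \<xi>: "\<xi> \<in> ?Q"
      have "fourier m (f + g) \<phi> = fourier m f \<phi> + fourier m g \<phi>" if "\<phi> \<in> Xplus R" for \<phi>
        unfolding fourier_eq_inner plus_fun_def
        using that Xplus_dual by (intro L2_inner_add_left fg dual_group_L2) auto
      then have "((\<lambda>\<phi>. fourier m f \<phi> * (\<mu> \<phi> * a (\<phi> * \<xi>)) + fourier m g \<phi> * (\<mu> \<phi> * a (\<phi> * \<xi>)))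
          has_sum L2_inner m (B (f + g)) (cnj \<circ> \<xi>)) (Xplus R)"
        using B_sum[OF sum \<xi>] by (simp add: ring_distribs cong: has_sum_cong)
      from has_sum_unique[OF this has_sum_add[OF B_sum[OF f \<xi>] B_sum[OF g \<xi>]]]
      show "L2_inner m (B (f + g)) (cnj \<circ> \<xi>) = L2_inner m (B f + B g) (cnj \<circ> \<xi>)"
        unfolding plus_fun_def by (simp add: L2_inner_add_left BL2 f g character_L2_cnj[OF \<xi>])
    qed
  next
    fix k f assume f: "f \<in> H2 m R"
    show "L2_eq m (B (\<lambda>x. k * f x)) (\<lambda>x. k * B f x)"
    proof (rule H2_minus_eqI)
      show "B (\<lambda>x. k * f x) \<in> H2_minus m R" by (rule B(1)[OF H2_scale[OF f]])
      show "(\<lambda>x. k * B f x) \<in> H2_minus m R" by (rule H2_minus_scale[OF B(1)[OF f]])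
      fix \<xi> assume \<xi>: "\<xi> \<in> ?Q"
      have "((\<lambda>\<phi>. k * (fourier m f \<phi> * (\<mu> \<phi> * a (\<phi> * \<xi>)))) has_sum L2_inner m (B (\<lambda>x. k * f x)) (cnj \<circ> \<xi>)) (Xplus R)"
        using B_sum[OF H2_scale[OF f] \<xi>] by (simp add: fourier_eq_inner L2_inner_scale_left mult.assoc)
      from has_sum_unique[OF this has_sum_cmult_right[OF B_sum[OF f \<xi>]]]
      show "L2_inner m (B (\<lambda>x. k * f x)) (cnj \<circ> \<xi>) = L2_inner m (\<lambda>x. k * B f x) (cnj \<circ> \<xi>)"
        by (simp add: L2_inner_scale_left)
    qed
  qed (rule B(1))
  moreover have "L2_norm m (B f) \<le> ell2_norm (Xplus R) \<mu> * ell2_norm ?Q a * L2_norm m f"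
    if f: "f \<in> H2 m R" for f
    by (rule H2_minus_norm_le[OF \<mu> a f B(1)[OF f] B_sum[OF f]])
  ultimately have "bounded_op m (H2 m R) (H2_minus m R) B"
    unfolding bounded_op_def by blast
  moreover have "L2_eq m (B f) (A f)" if span: "f \<in> char_span (Xplus R)" for f
  proof -
    obtain T c where T: "finite T" "T \<subseteq> Xplus R" and f: "f = char_sum T c"
      using span unfolding char_span_eq by blast
    have TX: "T \<subseteq> dual_group" using T Xplus_dual by blast
    have fH2: "f \<in> H2 m R" unfolding f by (rule char_sum_H2[OF T])
    show ?thesis
    proof (rule H2_minus_eqI)
      show "B f \<in> H2_minus m R" by (rule B(1)[OF fH2])
      show "A f \<in> H2_minus m R" by (rule mu_hankel_into[OF A span])
      fix \<xi> assume \<xi>: "\<xi> \<in> ?Q"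
      have "((\<lambda>\<phi>. fourier m f \<phi> * (\<mu> \<phi> * a (\<phi> * \<xi>))) has_sum (\<Sum>\<phi>\<in>T. c \<phi> * (\<mu> \<phi> * a (\<phi> * \<xi>)))) (Xplus R)"
      proof (rule has_sum_finite_neutralI[OF T])
        show "(\<Sum>\<phi>\<in>T. c \<phi> * (\<mu> \<phi> * a (\<phi> * \<xi>))) = (\<Sum>\<phi>\<in>T. fourier m f \<phi> * (\<mu> \<phi> * a (\<phi> * \<xi>)))"
          using T TX by (intro sum.cong refl) (simp add: f fourier_char_sum subsetD)
      qed (use T TX Xplus_dual in \<open>auto simp: f fourier_char_sum\<close>)
      from has_sum_unique[OF B_sum[OF fH2 \<xi>] this] mu_hankel_char_sum[OF A T \<xi>, of c]
      show "L2_inner m (B f) (cnj \<circ> \<xi>) = L2_inner m (A f) (cnj \<circ> \<xi>)" by (simp add: f)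
    qed
  qed
  ultimately have "bounded_extension m R A B" by (simp add: bounded_extension_def)
  then show ?thesis by (rule that)
qed

end

theorem theorem4:
  fixes m :: "'g::{topological_ab_group_add, t2_space} measure"
    and R :: "('g \<Rightarrow> complex) rel"
    and \<mu> a :: "('g \<Rightarrow> complex) \<Rightarrow> complex"
    and D :: "('g \<Rightarrow> complex) set"
    and A :: "('g \<Rightarrow> complex) \<Rightarrow> ('g \<Rightarrow> complex)"
  assumes "compact (UNIV :: 'g set)" and "connected (UNIV :: 'g set)"
    and "normalized_haar m"
    and "dual_order R"
    and "semi_character R \<mu>" and "ell2 (Xplus R) \<mu>"
    and "mu_hankel m R \<mu> a D A"
  shows "((\<exists>B. bounded_extension m R A B) \<longleftrightarrow> ell2 (Xplus R - {1}) a) \<and>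
    (ell2 (Xplus R - {1}) a \<longrightarrow>
      (\<forall>B B'. bounded_extension m R A B \<and> bounded_extension m R A B' \<longrightarrow>
         (\<forall>f\<in>H2 m R. L2_eq m (B f) (B' f))) \<and>
      (\<forall>B. bounded_extension m R A B \<longrightarrow>
         op_norm m (H2 m R) B \<le> ell2_norm (Xplus R) \<mu> * ell2_norm (Xplus R - {1}) a))"
proof -
  interpret prob_space m using assms(3) by (simp add: normalized_haar_def)
  interpret hardy_space m R by unfold_locales (use assms in auto)
  have "\<mu> 1 = 1"
  proof -
    obtain \<phi> where \<phi>: "\<phi> \<in> Xplus R" "\<mu> \<phi> \<noteq> 0" using assms(5) by (auto simp: semi_character_def)
    have "\<mu> (\<phi> * 1) = \<mu> \<phi> * \<mu> 1" using assms(5) \<phi>(1) one_Xplus unfolding semi_character_def by blast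
    then show ?thesis using \<phi>(2) by simp
  qed
  then have a: "ell2 (Xplus R - {1}) a" by (rule ell2_of_mu_hankel[OF assms(7)])
  have into: "B f \<in> H2_minus m R" if "bounded_extension m R A B" "f \<in> H2 m R" for B f
    using that by (auto simp: bounded_extension_def bounded_op_def linear_op_def)
  have "L2_eq m (B f) (B' f)"
    if B: "bounded_extension m R A B" "bounded_extension m R A B'" and f: "f \<in> H2 m R" for B B' f
    using bounded_extension_coeff[OF assms(7) _ f] B has_sum_unique
    by (intro H2_minus_eqI into f B) blast
  moreover have "op_norm m (H2 m R) B \<le> ell2_norm (Xplus R) \<mu> * ell2_norm (Xplus R - {1}) a"
    if B: "bounded_extension m R A B" for B
    unfolding op_norm_def
  proof (rule cSUP_least)
    show "H2 m R \<noteq> {}" using char_sum_H2[of "{}"] by auto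
    fix f assume f: "f \<in> H2 m R"
    have le: "L2_norm m (B f) \<le> ell2_norm (Xplus R) \<mu> * ell2_norm (Xplus R - {1}) a * L2_norm m f"
      by (rule H2_minus_norm_le[OF assms(6) a f into[OF B f] bounded_extension_coeff[OF assms(7) B f]])
    show "L2_norm m (B f) / L2_norm m f \<le> ell2_norm (Xplus R) \<mu> * ell2_norm (Xplus R - {1}) a"
    proof (cases "L2_norm m f = 0")
      case True
      then show ?thesis by (simp add: ell2_norm_def infsum_nonneg)
    next
      case False
      then have "L2_norm m f > 0" by (simp add: less_le)
      then show ?thesis using le by (simp add: pos_divide_le_eq)
    qed
  qed
  moreover have "\<exists>B. bounded_extension m R A B"
    using bounded_extension_exists[OF assms(7,6) a] by blast
  ultimately show ?thesis using a by blast
qed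

end
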